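(* Let $f:\mathbb{R}^{2}\rightarrow \mathbb{R}^{2}$, $f=(f_1,f_2)$, be an entire smooth map whose graph $G_f=\{(x,y,f_1(x,y),f_2(x,y)):(x,y)\in\mathbb{R}^2\}$ is a minimal surface in $\mathbb{R}^4$, with Gaussian curvature $K$ and normal curvature $K_N$. Then $$\inf_{K<0}\frac{|K_N|}{|K|}=0,$$ (the infimum taken over the points of $G_f$ where $K<0$), unless $G_f$ is a complex analytic curve.
   Context: For a surface in $\mathbb{R}^4$ with a local orthonormal frame $\{e_1,e_2;\xi_3,\xi_4\}$, $e_1,e_2$ tangent and $\xi_3,\xi_4$ normal, set $h^{\alpha}_{ij}=\langle \overline{\nabla}_{e_i}\xi_\alpha,e_j\rangle$, where $\overline\nabla$ is the Euclidean connection. The Gauss curvature is $K=\sum_{\alpha=3}^4(h^\alpha_{11}h^\alpha_{22}-(h^\alpha_{12})^2)$ and the normal curvature is $K_N=\sum_{i=1}^2(h^3_{i1}h^4_{2i}-h^3_{2i}h^4_{1i})$ (its absolute value does not depend on the choice of frame). A complex analytic curve is the graph $\{(z,\Phi(z)):z\in\mathbb{C}\}\subset\mathbb{C}^2=\mathbb{R}^4$ of an entire holomorphic or anti-holomorphic function $\Phi:\mathbb{C}\to\mathbb{C}$; for $G_f$ this means that $f_1+if_2$, regarded as a function of $z=x+iy$, is holomorphic or anti-holomorphic.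
   Formalization: The infimum is claimed to be 0 only if some point of the graph has K<0; without this the claim fails for flat graphs such as f(x,y)=(x,0), which is minimal, not complex analytic, and has no point with K<0. *)

theory Defs
  imports "HOL-Analysis.Analysis"
begin

definition cdir :: "nat \<Rightarrow> real \<times> real" where
  "cdir i = (if i = 1 then (1, 0) else (0, 1))"

definition partial :: "nat \<Rightarrow> (real \<times> real \<Rightarrow> real) \<Rightarrow> (real \<times> real \<Rightarrow> real)" where
  "partial i g = (\<lambda>p. deriv (\<lambda>t. g (p + t *\<^sub>R cdir i)) 0)"

fun iter_partial :: "nat list \<Rightarrow> (real \<times> real \<Rightarrow> real) \<Rightarrow> (real \<times> real \<Rightarrow> real)" where
  "iter_partial [] g = g"
| "iter_partial (i # is) g = partial i (iter_partial is g)"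

definition smooth2 :: "(real \<times> real \<Rightarrow> real) \<Rightarrow> bool" where
  "smooth2 g \<longleftrightarrow> (\<forall>is. set is \<subseteq> {1, 2} \<longrightarrow> (\<forall>p. iter_partial is g differentiable at p))"

definition smooth_map2 :: "(real \<times> real \<Rightarrow> real \<times> real) \<Rightarrow> bool" where
  "smooth_map2 f \<longleftrightarrow> smooth2 (\<lambda>p. fst (f p)) \<and> smooth2 (\<lambda>p. snd (f p))"

definition graph_map :: "(real \<times> real \<Rightarrow> real \<times> real) \<Rightarrow> real \<times> real \<Rightarrow> real^4" where
  "graph_map f p = vector [fst p, snd p, fst (f p), snd (f p)]"

definition dX :: "(real \<times> real \<Rightarrow> real \<times> real) \<Rightarrow> real \<times> real \<Rightarrow> real \<times> real \<Rightarrow> real^4" where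
  "dX f p u = (\<Sum>a\<in>{1::nat,2}. (if a = 1 then fst u else snd u) *\<^sub>R
      vector [fst (cdir a), snd (cdir a),
              partial a (\<lambda>q. fst (f q)) p, partial a (\<lambda>q. snd (f q)) p])"

definition D2X :: "(real \<times> real \<Rightarrow> real \<times> real) \<Rightarrow> real \<times> real \<Rightarrow> real \<times> real \<Rightarrow> real \<times> real \<Rightarrow> real^4" where
  "D2X f p u v = (\<Sum>a\<in>{1::nat,2}. \<Sum>b\<in>{1::nat,2}.
      ((if a = 1 then fst u else snd u) * (if b = 1 then fst v else snd v)) *\<^sub>R
      vector [0, 0, iter_partial [a, b] (\<lambda>q. fst (f q)) p,
                    iter_partial [a, b] (\<lambda>q. snd (f q)) p])"

definition frame_vec :: "(real \<times> real \<Rightarrow> real \<times> real) \<Rightarrow> real \<times> real \<Rightarrow>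
    (nat \<Rightarrow> real \<times> real) \<Rightarrow> (nat \<Rightarrow> real^4) \<Rightarrow> nat \<Rightarrow> real^4" where
  "frame_vec f p u xi k = (if k \<in> {1, 2} then dX f p (u k) else xi k)"

definition adapted_frame :: "(real \<times> real \<Rightarrow> real \<times> real) \<Rightarrow> real \<times> real \<Rightarrow>
    (nat \<Rightarrow> real \<times> real) \<Rightarrow> (nat \<Rightarrow> real^4) \<Rightarrow> bool" where
  "adapted_frame f p u xi \<longleftrightarrow>
     (\<forall>k\<in>{1,2,3,4::nat}. \<forall>l\<in>{1,2,3,4::nat}.
        frame_vec f p u xi k \<bullet> frame_vec f p u xi l = (if k = l then 1 else 0))"

text \<open>Coefficients h^alpha_ij = < D_{e_i} xi_alpha, e_j > of the second fundamental form.
  Since <xi_alpha, e_j> = 0, this equals - < xi_alpha, D_{e_i} e_j > = - < xi_alpha, D^2X_p(u_i,u_j) >,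
  which depends only on the frame at the point.\<close>

definition hcoef :: "(real \<times> real \<Rightarrow> real \<times> real) \<Rightarrow> real \<times> real \<Rightarrow>
    (nat \<Rightarrow> real \<times> real) \<Rightarrow> (nat \<Rightarrow> real^4) \<Rightarrow> nat \<Rightarrow> nat \<Rightarrow> nat \<Rightarrow> real" where
  "hcoef f p u xi \<alpha> i j = - (xi \<alpha> \<bullet> D2X f p (u i) (u j))"

definition gauss_frame :: "(real \<times> real \<Rightarrow> real \<times> real) \<Rightarrow> real \<times> real \<Rightarrow>
    (nat \<Rightarrow> real \<times> real) \<Rightarrow> (nat \<Rightarrow> real^4) \<Rightarrow> real" where
  "gauss_frame f p u xi = (\<Sum>\<alpha>\<in>{3,4::nat}.
      hcoef f p u xi \<alpha> 1 1 * hcoef f p u xi \<alpha> 2 2 - (hcoef f p u xi \<alpha> 1 2)^2)"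

definition normal_frame :: "(real \<times> real \<Rightarrow> real \<times> real) \<Rightarrow> real \<times> real \<Rightarrow>
    (nat \<Rightarrow> real \<times> real) \<Rightarrow> (nat \<Rightarrow> real^4) \<Rightarrow> real" where
  "normal_frame f p u xi = (\<Sum>i\<in>{1,2::nat}.
      hcoef f p u xi 3 i 1 * hcoef f p u xi 4 2 i - hcoef f p u xi 3 2 i * hcoef f p u xi 4 1 i)"

text \<open>Gauss curvature K and normal curvature K_N of G_f at X(p), computed with some adapted frame
  (K does not depend on the frame, |K_N| neither).\<close>

definition some_frame :: "(real \<times> real \<Rightarrow> real \<times> real) \<Rightarrow> real \<times> real \<Rightarrow>
    (nat \<Rightarrow> real \<times> real) \<times> (nat \<Rightarrow> real^4)" where
  "some_frame f p = (SOME fr. adapted_frame f p (fst fr) (snd fr))"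

definition gauss_curv :: "(real \<times> real \<Rightarrow> real \<times> real) \<Rightarrow> real \<times> real \<Rightarrow> real" where
  "gauss_curv f p = gauss_frame f p (fst (some_frame f p)) (snd (some_frame f p))"

definition normal_curv :: "(real \<times> real \<Rightarrow> real \<times> real) \<Rightarrow> real \<times> real \<Rightarrow> real" where
  "normal_curv f p = normal_frame f p (fst (some_frame f p)) (snd (some_frame f p))"

definition minimal_graph :: "(real \<times> real \<Rightarrow> real \<times> real) \<Rightarrow> bool" where
  "minimal_graph f \<longleftrightarrow> (\<forall>p u xi. adapted_frame f p u xi \<longrightarrow>
      (\<forall>\<alpha>\<in>{3,4::nat}. hcoef f p u xi \<alpha> 1 1 + hcoef f p u xi \<alpha> 2 2 = 0))"

definition complex_analytic_graph :: "(real \<times> real \<Rightarrow> real \<times> real) \<Rightarrow> bool" where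
  "complex_analytic_graph f \<longleftrightarrow>
     (let \<Phi> = (\<lambda>z. Complex (fst (f (Re z, Im z))) (snd (f (Re z, Im z)))) in
       \<Phi> holomorphic_on UNIV \<or> (\<lambda>z. cnj (\<Phi> z)) holomorphic_on UNIV)"

end

theory Submission
  imports Defs "HOL-Complex_Analysis.Conformal_Mappings"
begin

text \<open>Write g for the induced metric and W for the square root of det g. Minimality makes the rows of g/W
  closed one-forms, so g/W is the Hessian of a convex function whose Hessian has determinant 1. By
  Joergens' theorem (proved by Lewy's transformation and Liouville's theorem) such a Hessian is constant,
  so a linear change of the parameters is isothermal on the whole plane. The complex gradients G1, G2
  of the two components are then entire and G1^2 + G2^2 is a constant e, that is,
  (G1 + i G2)(G1 - i G2) = e.

  If e = 0, one factor vanishes identically, which is the Cauchy-Riemann system for f or its conjugate.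
  If e is nonzero, |K_N|/|K| is at most W times the quotient of the difference and the sum of the squared
  moduli of the two factors. Unless they are constant (and K = 0), Liouville's theorem gives a point
  where the moduli coincide, and K < 0 at points arbitrarily close to it.\<close>

text \<open>Closedness of the rows is where both component equations enter: the discrepancy of the
  cross derivatives is a combination, with first derivatives as factors, of
  \<open>metric22 f_xx - 2 metric12 f_xy + metric11 f_yy\<close> for the two components. The
  constant e arises because \<kappa> = (R + i)/Q is a root of P - 2 R \<kappa> + Q \<kappa>^2, so
  the varying factor W drops out of the metric evaluated on X_x - \<kappa> X_y. The curvatures
  involve second derivatives, while the moduli compared at the end involve first ones. The bridge is
  to differentiate the product equal to e: its two factors have opposite logarithmic derivatives, so
  the moduli of their derivatives are in the same proportion as their own moduli. Two obstacles
  shape the end. W need not be bounded, so the estimate is exploited only near one point, where W is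
  continuous. And K may vanish at that very point, if the factors are critical there, so it is only
  approached. As the curvatures are taken in a chosen frame, K and the square of K_N are first
  rewritten without frames; the sign of K_N depends on the frame.\<close>

declare One_nat_def [simp del]

section \<open>Functions on the plane\<close>

lemma has_derivative_continuous_partials:
  fixes F :: "real \<times> real \<Rightarrow> real"
  assumes x: "\<And>x y. ((\<lambda>x. F (x, y)) has_real_derivative a (x, y)) (at x)"
    and y: "\<And>x y. ((\<lambda>y. F (x, y)) has_real_derivative b (x, y)) (at y)"
    and b: "continuous_on UNIV b"
  shows "(F has_derivative (\<lambda>h. a z * fst h + b z * snd h)) (at z)"
proof -
  obtain x0 y0 where z: "z = (x0, y0)" by fastforce
  have "((\<lambda>(x, y). F (x, y)) has_derivative
      (\<lambda>(tx, ty). a (x0, y0) * tx + blinfun_scaleR_left (b (x0, y0)) ty)) (at (x0, y0) within UNIV \<times> UNIV)"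
  proof (rule has_derivative_partialsI)
    show "((\<lambda>x. F (x, y0)) has_derivative (*) (a (x0, y0))) (at x0 within UNIV)"
      using x by (simp add: has_field_derivative_def)
    show "((\<lambda>y. F (x, y)) has_derivative blinfun_apply (blinfun_scaleR_left (b (x, y)))) (at y within UNIV)" for x y
      using y[of x y] unfolding has_field_derivative_def
      by (rule has_derivative_eq_rhs) (simp add: fun_eq_iff)
    have "isCont b (x0, y0)"
      using b by (simp add: continuous_on_eq_continuous_at)
    then show "continuous (at (x0, y0) within UNIV \<times> UNIV) (\<lambda>(x, y). blinfun_scaleR_left (b (x, y)))"
      unfolding split_beta prod.collapse by (auto intro!: continuous_intros)
  qed auto
  then show ?thesis
    unfolding z split_beta prod.collapse by (simp add: mult.commute[of "b _"])
qed

lemma has_derivative_fst_line: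
  fixes F :: "real \<times> real \<Rightarrow> real"
  assumes "(F has_derivative (\<lambda>h. a * fst h + b * snd h)) (at (x, y))"
  shows "((\<lambda>x. F (x, y)) has_real_derivative a) (at x)"
proof -
  have "((\<lambda>x. (x, y)) has_derivative (\<lambda>t. (t, 0))) (at x)"
    by (auto intro!: derivative_eq_intros)
  from has_derivative_compose[OF this assms] show ?thesis
    by (simp add: has_field_derivative_def)
qed

lemma has_derivative_snd_line:
  fixes F :: "real \<times> real \<Rightarrow> real"
  assumes "(F has_derivative (\<lambda>h. a * fst h + b * snd h)) (at (x, y))"
  shows "((\<lambda>y. F (x, y)) has_real_derivative b) (at y)"
proof -
  have "((\<lambda>y. (x, y)) has_derivative (\<lambda>t. (0, t))) (at y)"
    by (auto intro!: derivative_eq_intros)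
  from has_derivative_compose[OF this assms] show ?thesis
    by (simp add: has_field_derivative_def)
qed

lemma has_derivative_line_segment:
  fixes F :: "real \<times> real \<Rightarrow> real"
  assumes "\<And>z. (F has_derivative (\<lambda>h. a z * fst h + b z * snd h)) (at z)"
  shows "((\<lambda>t. F (x + t * u, y + t * v)) has_real_derivative
      a (x + t * u, y + t * v) * u + b (x + t * u, y + t * v) * v) (at t)"
proof -
  have "((\<lambda>t. (x + t * u, y + t * v)) has_derivative (\<lambda>t. (t * u, t * v))) (at t)"
    by (auto intro!: derivative_eq_intros)
  from has_derivative_compose[OF this assms] show ?thesis
    unfolding has_field_derivative_def
    by (rule has_derivative_eq_rhs) (simp add: fun_eq_iff algebra_simps)
qed

lemma continuous_on_has_derivative_plane:
  fixes F :: "real \<times> real \<Rightarrow> real"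
  assumes "\<And>z. (F has_derivative (\<lambda>h. a z * fst h + b z * snd h)) (at z)"
  shows "continuous_on UNIV F"
  using assms by (meson continuous_at_imp_continuous_on has_derivative_continuous)

text \<open>Schwarz's theorem by differentiation under the integral sign: the increment of
  \<open>F\<close> in y is an integral of \<open>b\<close>, so the increment of \<open>a\<close> in
  y is the integral of \<open>bx\<close>, and the fundamental theorem returns \<open>bx\<close> as
  the y-derivative of \<open>a\<close>.\<close>

lemma mixed_derivatives_eq:
  fixes F :: "real \<times> real \<Rightarrow> real"
  assumes F: "\<And>z. (F has_derivative (\<lambda>h. a z * fst h + b z * snd h)) (at z)"
    and a: "\<And>z. (a has_derivative (\<lambda>h. ax z * fst h + ay z * snd h)) (at z)"
    and b: "\<And>z. (b has_derivative (\<lambda>h. bx z * fst h + by z * snd h)) (at z)"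
    and cont: "continuous_on UNIV bx"
  shows "ay z = bx z"
proof -
  obtain x0 y0 where z: "z = (x0, y0)" by fastforce
  \<comment> \<open>Starting strictly below \<open>y0\<close> makes \<open>y0\<close> interior to
    \<open>{c..y0 + 1}\<close>, so the derivative within that interval is the full
    derivative.\<close>
  define c where "c = y0 - 1"
  have c_le: "c \<le> y0" by (simp add: c_def)
  have cb: "continuous_on UNIV b" by (rule continuous_on_has_derivative_plane[OF b])
  have FTC: "((\<lambda>t. b (x, t)) has_integral F (x, y) - F (x, c)) (cbox c y)" if "c \<le> y" for x y
    unfolding box_real
    by (rule fundamental_theorem_of_calculus[OF that])
       (use has_derivative_snd_line[OF F] in \<open>auto simp: has_real_derivative_iff_has_vector_derivative[symmetric] intro: has_field_derivative_at_within\<close>)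
  have diff: "a (x0, y) - a (x0, c) = integral (cbox c y) (\<lambda>t. bx (x0, t))" if "c \<le> y" for y
  proof (rule DERIV_unique)
    have "((\<lambda>x. integral (cbox c y) (\<lambda>t. b (x, t))) has_field_derivative
        integral (cbox c y) (\<lambda>t. bx (x0, t))) (at x0 within UNIV)"
    proof (rule leibniz_rule_field_derivative)
      show "((\<lambda>x. b (x, t)) has_real_derivative bx (x, t)) (at x within UNIV)" for x t
        by (rule has_derivative_fst_line[OF b])
      show "(\<lambda>t. b (x, t)) integrable_on cbox c y" for x
        by (intro integrable_continuous continuous_on_compose2[OF cb]) (auto intro!: continuous_intros)
      show "continuous_on (UNIV \<times> cbox c y) (\<lambda>(x, t). bx (x, t))"
        using continuous_on_subset[OF cont] by (simp add: split_beta)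
    qed auto
    moreover have "integral (cbox c y) (\<lambda>t. b (x, t)) = F (x, y) - F (x, c)" for x
      using FTC[OF that] by (rule integral_unique)
    ultimately show "((\<lambda>x. F (x, y) - F (x, c)) has_real_derivative
        integral (cbox c y) (\<lambda>t. bx (x0, t))) (at x0)" by simp
    show "((\<lambda>x. F (x, y) - F (x, c)) has_real_derivative a (x0, y) - a (x0, c)) (at x0)"
      by (intro DERIV_diff has_derivative_fst_line[OF F])
  qed
  have eq: "a (x0, y) = a (x0, c) + integral {c..y} (\<lambda>t. bx (x0, t))" if "c \<le> y" for y
    using diff[OF that] by (simp add: diff_eq_eq)
  have "((\<lambda>y. integral {c..y} (\<lambda>t. bx (x0, t))) has_real_derivative bx (x0, y0)) (at y0 within {c..y0 + 1})"
  proof (rule integral_has_real_derivative)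
    show "continuous_on {c..y0 + 1} (\<lambda>t. bx (x0, t))"
      by (intro continuous_on_compose2[OF cont] continuous_intros) auto
  qed (simp add: c_def)
  then have "((\<lambda>y. a (x0, c) + integral {c..y} (\<lambda>t. bx (x0, t))) has_real_derivative 0 + bx (x0, y0)) (at y0 within {c..y0 + 1})"
    by (intro DERIV_add DERIV_const)
  then have "((\<lambda>y. a (x0, c) + integral {c..y} (\<lambda>t. bx (x0, t))) has_real_derivative bx (x0, y0)) (at y0 within {c..y0 + 1})"
    by simp
  then have "((\<lambda>y. a (x0, y)) has_real_derivative bx (x0, y0)) (at y0 within {c..y0 + 1})"
  proof (rule has_field_derivative_transform_within[where d=1])
    show "a (x0, c) + integral {c..y} (\<lambda>t. bx (x0, t)) = a (x0, y)" if "y \<in> {c..y0 + 1}" for y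
      using eq[of y] that by auto
  qed (auto simp: c_le)
  moreover have "at y0 within {c..y0 + 1} = at y0"
    by (rule at_within_interior) (auto simp: c_def)
  ultimately show ?thesis
    using DERIV_unique[OF _ has_derivative_snd_line[OF a]] by (auto simp: z)
qed

text \<open>Poincare's lemma for the form a dx + b dy; closedness is encoded by the shared
  \<open>m\<close>. The potential is the integral of the form along the ray from the origin.\<close>

lemma closed_form_potential:
  fixes a b :: "real \<times> real \<Rightarrow> real"
  assumes a: "\<And>z. (a has_derivative (\<lambda>h. ax z * fst h + m z * snd h)) (at z)"
    and b: "\<And>z. (b has_derivative (\<lambda>h. m z * fst h + by z * snd h)) (at z)"
    and cont: "continuous_on UNIV ax" "continuous_on UNIV m" "continuous_on UNIV by"
  obtains F where "\<And>z. (F has_derivative (\<lambda>h. a z * fst h + b z * snd h)) (at z)"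
proof
  define F where "F z = integral (cbox 0 1) (\<lambda>t. a (t * fst z, t * snd z) * fst z + b (t * fst z, t * snd z) * snd z)" for z
  have ca: "continuous_on UNIV a" and cb: "continuous_on UNIV b"
    using continuous_on_has_derivative_plane a b by blast+
  note ci = continuous_on_compose2[OF ca] continuous_on_compose2[OF cb]
    continuous_on_compose2[OF cont(1)] continuous_on_compose2[OF cont(2)] continuous_on_compose2[OF cont(3)]
  have ray: "((\<lambda>t. t * g (t * x, t * y)) has_real_derivative
      t * (gx (t * x, t * y) * x + gy (t * x, t * y) * y) + g (t * x, t * y)) (at t)"
    if g: "\<And>z. (g has_derivative (\<lambda>h. gx z * fst h + gy z * snd h)) (at z)" for g gx gy :: "real \<times> real \<Rightarrow> real" and x y t
    using has_derivative_line_segment[OF g, of 0 x 0 y t]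
    by (auto intro!: derivative_eq_intros)
  \<comment> \<open>The integrand is the t-derivative of t g(tx, ty). Differentiating
    \<open>F\<close> under the integral produces exactly this integrand, with g = a or g = b, thanks
    to closedness.\<close>
  have ray_int: "integral (cbox 0 1) (\<lambda>t. t * (gx (t * x, t * y) * x + gy (t * x, t * y) * y) + g (t * x, t * y)) = g (x, y)"
    if g: "\<And>z. (g has_derivative (\<lambda>h. gx z * fst h + gy z * snd h)) (at z)" for g gx gy :: "real \<times> real \<Rightarrow> real" and x y
    unfolding box_real
  proof (rule integral_unique)
    have "((\<lambda>t. t * (gx (t * x, t * y) * x + gy (t * x, t * y) * y) + g (t * x, t * y)) has_integral
        1 * g (1 * x, 1 * y) - 0 * g (0 * x, 0 * y)) {0..1}"
      by (rule fundamental_theorem_of_calculus)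
         (use ray[OF g] in \<open>auto simp: has_real_derivative_iff_has_vector_derivative[symmetric] intro: has_field_derivative_at_within\<close>)
    then show "((\<lambda>t. t * (gx (t * x, t * y) * x + gy (t * x, t * y) * y) + g (t * x, t * y)) has_integral g (x, y)) {0..1}"
      by simp
  qed
  show "(F has_derivative (\<lambda>h. a z * fst h + b z * snd h)) (at z)" for z
  proof (rule has_derivative_continuous_partials[OF _ _ cb])
    fix x y :: real
    have 1: "((\<lambda>x. a (t * x, t * y)) has_real_derivative t * ax (t * x, t * y)) (at x)"
            "((\<lambda>x. b (t * x, t * y)) has_real_derivative t * m (t * x, t * y)) (at x)" 
            "((\<lambda>y. a (t * x, t * y)) has_real_derivative t * m (t * x, t * y)) (at y)"
            "((\<lambda>y. b (t * x, t * y)) has_real_derivative t * by (t * x, t * y)) (at y)" for t x y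
      using has_derivative_line_segment[OF a, of 0 t "t * y" 0 x] has_derivative_line_segment[OF b, of 0 t "t * y" 0 x]
        has_derivative_line_segment[OF a, of "t * x" 0 0 t y] has_derivative_line_segment[OF b, of "t * x" 0 0 t y]
      by (auto simp: mult.commute)
    have "((\<lambda>x. F (x, y)) has_field_derivative
        integral (cbox 0 1) (\<lambda>t. t * (ax (t * x, t * y) * x + m (t * x, t * y) * y) + a (t * x, t * y))) (at x within UNIV)"
      unfolding F_def fst_conv snd_conv
    proof (rule leibniz_rule_field_derivative)
      show "((\<lambda>x. a (t * x, t * y) * x + b (t * x, t * y) * y) has_real_derivative
          t * (ax (t * x, t * y) * x + m (t * x, t * y) * y) + a (t * x, t * y)) (at x within UNIV)" for x t
        by (rule derivative_eq_intros 1 refl)+ (simp add: algebra_simps)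
      show "(\<lambda>t. a (t * x, t * y) * x + b (t * x, t * y) * y) integrable_on cbox 0 1" for x
        by (intro integrable_continuous continuous_intros ci) auto
      show "continuous_on (UNIV \<times> cbox 0 1) (\<lambda>(x, t).
          t * (ax (t * x, t * y) * x + m (t * x, t * y) * y) + a (t * x, t * y))"
        unfolding split_beta by (intro continuous_intros ci) auto
    qed auto
    then show "((\<lambda>x. F (x, y)) has_real_derivative a (x, y)) (at x)"
      by (simp add: ray_int[OF a, unfolded box_real])
    have "((\<lambda>y. F (x, y)) has_field_derivative
        integral (cbox 0 1) (\<lambda>t. t * (m (t * x, t * y) * x + by (t * x, t * y) * y) + b (t * x, t * y))) (at y within UNIV)"
      unfolding F_def fst_conv snd_conv
    proof (rule leibniz_rule_field_derivative)
      show "((\<lambda>y. a (t * x, t * y) * x + b (t * x, t * y) * y) has_real_derivative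
          t * (m (t * x, t * y) * x + by (t * x, t * y) * y) + b (t * x, t * y)) (at y within UNIV)" for y t
        by (rule derivative_eq_intros 1 refl)+ (simp add: algebra_simps)
      show "(\<lambda>t. a (t * x, t * y) * x + b (t * x, t * y) * y) integrable_on cbox 0 1" for y
        by (intro integrable_continuous continuous_intros ci) auto
      show "continuous_on (UNIV \<times> cbox 0 1) (\<lambda>(y, t).
          t * (m (t * x, t * y) * x + by (t * x, t * y) * y) + b (t * x, t * y))"
        unfolding split_beta by (intro continuous_intros ci) auto
    qed auto
    then show "((\<lambda>y. F (x, y)) has_real_derivative b (x, y)) (at y)"
      by (simp add: ray_int[OF b, unfolded box_real])
  qed
qed

section \<open>Constancy of unimodular Hessians\<close>

lemma has_derivative_Re_Im:
  fixes F :: "real \<times> real \<Rightarrow> real"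
  assumes "\<And>z. (F has_derivative (\<lambda>h. a z * fst h + b z * snd h)) (at z)"
  shows "((\<lambda>z. F (Re z, Im z)) has_derivative (\<lambda>h. a (Re z, Im z) * Re h + b (Re z, Im z) * Im h)) (at z)"
proof -
  have "((\<lambda>z. (Re z, Im z)) has_derivative (\<lambda>h. (Re h, Im h))) (at z)"
    by (intro has_derivative_Pair has_derivative_Re has_derivative_Im has_derivative_ident)
  from has_derivative_compose[OF this assms] show ?thesis by simp
qed

lemma has_derivative_Complex:
  assumes "(f has_derivative f') (at z within S)" "(g has_derivative g') (at z within S)"
  shows "((\<lambda>z. Complex (f z) (g z)) has_derivative (\<lambda>h. Complex (f' h) (g' h))) (at z within S)"
proof -
  have *: "Complex a b = of_real a + \<i> * of_real b" for a b
    by (simp add: complex_eq_iff)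
  show ?thesis
    unfolding * using assms by (auto intro!: derivative_eq_intros)
qed

text \<open>The range is closed, because preimages of a Cauchy sequence are again Cauchy, and open
  by invariance of domain, because \<open>T\<close> is injective. Connectedness of the space does
  the rest.\<close>

lemma expanding_imp_surj:
  fixes T :: "'a::euclidean_space \<Rightarrow> 'a"
  assumes cont: "continuous_on UNIV T" and exp: "\<And>x y. dist x y \<le> dist (T x) (T y)"
  shows "bij T"
proof -
  have inj: "inj T"
  proof (rule injI)
    fix x y assume "T x = T y"
    then show "x = y" using exp[of x y] by simp
  qed
  have "closed (range T)"
    unfolding closed_sequential_limits
  proof (intro allI impI, elim conjE)
    fix s l assume s: "\<forall>n. s n \<in> range T" "s \<longlonglongrightarrow> l"
    define z where "z n = inv T (s n)" for n
    have z: "s n = T (z n)" for n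
      using s(1) by (simp add: z_def f_inv_into_f)
    have "Cauchy s" by (rule LIMSEQ_imp_Cauchy[OF s(2)])
    then have "Cauchy z"
      unfolding Cauchy_def z using exp by (meson le_less_trans)
    then obtain z0 where "z \<longlonglongrightarrow> z0" using Cauchy_convergent_iff convergent_def by blast
    then have "(\<lambda>n. T (z n)) \<longlonglongrightarrow> T z0"
      using cont by (intro isCont_tendsto_compose[of _ T]) (auto simp: continuous_on_eq_continuous_at)
    then have "l = T z0"
      using s(2) LIMSEQ_unique unfolding z[symmetric] by blast
    then show "l \<in> range T" by simp
  qed
  moreover have "open (range T)"
    using invariance_of_domain[OF cont] inj by simp
  ultimately have "range T = UNIV"
    using clopen[of "range T"] by simp
  then show ?thesis using inj by (simp add: bij_def)
qed

text \<open>Joergens' theorem on entire convex solutions of det Hess = 1, stated for the entries p, r, q of the Hessian.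
  With (A, B) the gradient of the solution, Lewy's map T = id + (A, B) is an expanding homeomorphism, and
  (x - A) - i(y - B) is an entire function of T whose derivative is bounded by 1.\<close>

lemma unimodular_hessian_constant:
  fixes p r q :: "real \<times> real \<Rightarrow> real"
  assumes p: "\<And>z. (p has_derivative (\<lambda>h. px z * fst h + m1 z * snd h)) (at z)"
    and r: "\<And>z. (r has_derivative (\<lambda>h. m1 z * fst h + m2 z * snd h)) (at z)"
    and q: "\<And>z. (q has_derivative (\<lambda>h. m2 z * fst h + qy z * snd h)) (at z)"
    and cont: "continuous_on UNIV px" "continuous_on UNIV m1" "continuous_on UNIV m2" "continuous_on UNIV qy"
    and det: "\<And>z. p z * q z - (r z)\<^sup>2 = 1" and pos: "\<And>z. p z > 0"
  shows "p z = p z' \<and> r z = r z' \<and> q z = q z'"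
proof -
  obtain A where A: "\<And>z. (A has_derivative (\<lambda>h. p z * fst h + r z * snd h)) (at z)"
    using closed_form_potential[OF p r cont(1-3)] by blast
  obtain B where B: "\<And>z. (B has_derivative (\<lambda>h. r z * fst h + q z * snd h)) (at z)"
    using closed_form_potential[OF r q cont(2-4)] by blast
  define P where "P z = (Re z, Im z)" for z
  define T where "T z = Complex (Re z + A (P z)) (Im z + B (P z))" for z
  define N where "N z = Complex (Re z - A (P z)) (B (P z) - Im z)" for z
  have qpos: "q z > 0" for z
    using det[of z] pos[of z] by (smt (verit) zero_less_mult_pos zero_le_power2)
  have AP: "((\<lambda>z. A (P z)) has_derivative (\<lambda>h. p (P z) * Re h + r (P z) * Im h)) (at z)"
   and BP: "((\<lambda>z. B (P z)) has_derivative (\<lambda>h. r (P z) * Re h + q (P z) * Im h)) (at z)" for z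
    unfolding P_def by (rule has_derivative_Re_Im A B)+
  have T: "(T has_derivative (\<lambda>h. Complex (Re h + (p (P z) * Re h + r (P z) * Im h))
      (Im h + (r (P z) * Re h + q (P z) * Im h)))) (at z)" for z
    unfolding T_def[abs_def]
    by (intro has_derivative_Complex has_derivative_add has_derivative_Re has_derivative_Im has_derivative_ident AP BP)
  have N: "(N has_derivative (\<lambda>h. Complex (Re h - (p (P z) * Re h + r (P z) * Im h))
      ((r (P z) * Re h + q (P z) * Im h) - Im h))) (at z)" for z
    unfolding N_def[abs_def]
    by (intro has_derivative_Complex has_derivative_diff has_derivative_Re has_derivative_Im has_derivative_ident AP BP)
  \<comment> \<open>Monotonicity of the gradient of a convex function: the inner product with the
    direction is nondecreasing along the segment from \<open>z1\<close> to \<open>z2\<close>.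
    Multiplying the quadratic form by \<open>p w > 0\<close> and completing the square gives its
    sign.\<close>
  have mono: "(A (P z2) - A (P z1)) * Re (z2 - z1) + (B (P z2) - B (P z1)) * Im (z2 - z1) \<ge> 0" for z1 z2
  proof -
    let ?u = "Re (z2 - z1)" and ?v = "Im (z2 - z1)"
    let ?g = "\<lambda>t. (Re z1 + t * ?u, Im z1 + t * ?v)"
    have psd: "(p w * ?u + r w * ?v) * ?u + (r w * ?u + q w * ?v) * ?v \<ge> 0" for w
    proof -
      have "p w * ((p w * ?u + r w * ?v) * ?u + (r w * ?u + q w * ?v) * ?v)
          = (p w * ?u + r w * ?v)\<^sup>2 + (p w * q w - (r w)\<^sup>2) * ?v\<^sup>2"
        by (simp add: algebra_simps power2_eq_square)
      also have "\<dots> \<ge> 0" by (simp add: det)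
      finally show ?thesis using pos[of w] by (simp add: zero_le_mult_iff)
    qed
    have "A (?g 0) * ?u + B (?g 0) * ?v \<le> A (?g 1) * ?u + B (?g 1) * ?v"
    proof (rule DERIV_nonneg_imp_nondecreasing[of 0 1 "\<lambda>t. A (?g t) * ?u + B (?g t) * ?v"])
      fix t :: real
      have "((\<lambda>t. A (?g t) * ?u + B (?g t) * ?v) has_real_derivative
          (p (?g t) * ?u + r (?g t) * ?v) * ?u + (r (?g t) * ?u + q (?g t) * ?v) * ?v) (at t)"
        by (intro DERIV_add DERIV_cmult_right has_derivative_line_segment A B)
      then show "\<exists>y. ((\<lambda>t. A (?g t) * ?u + B (?g t) * ?v) has_real_derivative y) (at t) \<and> 0 \<le> y"
        using psd by blast
    qed simp
    then show ?thesis by (simp add: P_def algebra_simps)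
  qed
  have exp: "dist z1 z2 \<le> dist (T z1) (T z2)" for z1 z2
  proof -
    let ?h = "z2 - z1"
    have "(norm ?h)\<^sup>2 \<le> Re (T z2 - T z1) * Re ?h + Im (T z2 - T z1) * Im ?h"
      using mono[of z1 z2] unfolding cmod_power2 by (simp add: T_def power2_eq_square algebra_simps)
    also have "\<dots> = Re ((T z2 - T z1) * cnj ?h)" by (simp add: algebra_simps)
    also have "\<dots> \<le> norm ((T z2 - T z1) * cnj ?h)" by (rule complex_Re_le_cmod)
    also have "\<dots> = norm (T z2 - T z1) * norm ?h" by (simp only: norm_mult complex_mod_cnj)
    finally have "norm ?h \<le> norm (T z2 - T z1)"
      by (cases "z1 = z2") (simp_all add: power2_eq_square)
    then show ?thesis by (simp add: dist_norm norm_minus_commute)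
  qed
  have contT: "continuous_on UNIV T"
    using T by (meson continuous_at_imp_continuous_on has_derivative_continuous)
  have bij: "bij T" by (rule expanding_imp_surj[OF contT exp])
  define G where "G = inv T"
  have TG: "T (G y) = y" and GT: "G (T z) = z" for y z
    using bij by (simp_all add: G_def bij_is_surj surj_f_inv_f bij_is_inj)
  \<comment> \<open>The inverse of an expanding map is 1-Lipschitz; its continuity is what the
    derivative rule for inverses asks for.\<close>
  have "dist (G x) (G y) \<le> dist x y" for x y
    using exp[of "G x" "G y"] by (simp add: TG)
  then have contG: "isCont G y" for y
    unfolding continuous_at_eps_delta by (meson le_less_trans)
  \<comment> \<open>With H the Hessian, the real derivative of \<open>N\<close> after
    \<open>T\<close>'s inverse is diag(1, -1) (I - H) (I + H)^-1. Since det H = 1, det(I + H) = 2 +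
    p + q, and the matrix is multiplication by this complex number.\<close>
  define \<kappa> where "\<kappa> z = Complex ((q z - p z) / (2 + p z + q z)) (2 * r z / (2 + p z + q z))" for z
  have w: "((N \<circ> G) has_field_derivative \<kappa> (P (G y))) (at y)" for y
  proof -
    define a b c where "a = p (P (G y))" and "b = r (P (G y))" and "c = q (P (G y))"
    have abc: "a * c = 1 + b\<^sup>2" "2 + a + c \<noteq> 0" "2 + a + c > 0"
      using det[of "P (G y)"] pos[of "P (G y)"] qpos[of "P (G y)"] by (auto simp: a_def b_def c_def)
    \<comment> \<open>Cramer's rule for (I + H)^-1.\<close>
    let ?g' = "\<lambda>k. Complex (((1 + c) * Re k - b * Im k) / (2 + a + c)) (((1 + a) * Im k - b * Re k) / (2 + a + c))"
    have "(G has_derivative ?g') (at y)"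
    proof (rule has_derivative_inverse_basic[OF T _ _ _ open_UNIV UNIV_I])
      show "bounded_linear ?g'"
        by (rule linear_conv_bounded_linear[THEN iffD1])
           (auto intro!: linearI simp: complex_eq_iff add_divide_distrib diff_divide_distrib algebra_simps)
      have 1: "(1 + c) * (x + (a * x + b * y)) - b * (y + (b * x + c * y)) = x * (2 + a + c)"
           "(1 + a) * (y + (b * x + c * y)) - b * (x + (a * x + b * y)) = y * (2 + a + c)" for x y
        using abc(1) by algebra+
      show "?g' \<circ> (\<lambda>h. Complex (Re h + (p (P (G y)) * Re h + r (P (G y)) * Im h))
          (Im h + (r (P (G y)) * Re h + q (P (G y)) * Im h))) = id"
        unfolding a_def[symmetric] b_def[symmetric] c_def[symmetric]
        using abc(2) by (auto simp: fun_eq_iff complex_eq_iff 1)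
      show "continuous (at y) G" by (rule contG)
    qed (auto simp: TG)
    from has_derivative_compose[OF this N]
    have "((N \<circ> G) has_derivative (\<lambda>k. Complex (Re (?g' k) - (a * Re (?g' k) + b * Im (?g' k)))
      ((b * Re (?g' k) + c * Im (?g' k)) - Im (?g' k)))) (at y)"
      by (simp add: o_def a_def b_def c_def)
    then show ?thesis
      unfolding has_field_derivative_def
    proof (rule has_derivative_eq_rhs)
      let ?d = "2 + a + c"
      have 2: "((1 + c) * x - b * y) - (a * ((1 + c) * x - b * y) + b * ((1 + a) * y - b * x)) = (c - a) * x - 2 * b * y"
        "(b * ((1 + c) * x - b * y) + c * ((1 + a) * y - b * x)) - ((1 + a) * y - b * x) = (c - a) * y + 2 * b * x" for x y
        using abc(1) by algebra+
      have 3: "u / ?d - (a * (u / ?d) + b * (v / ?d)) = (u - (a * u + b * v)) / ?d"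
        "(b * (u / ?d) + c * (v / ?d)) - v / ?d = ((b * u + c * v) - v) / ?d" for u v
        by (simp_all add: diff_divide_distrib add_divide_distrib)
      show "(\<lambda>k. Complex (Re (?g' k) - (a * Re (?g' k) + b * Im (?g' k)))
          ((b * Re (?g' k) + c * Im (?g' k)) - Im (?g' k))) = (*) (\<kappa> (P (G y)))"
        unfolding \<kappa>_def a_def[symmetric] b_def[symmetric] c_def[symmetric]
        by (auto simp: fun_eq_iff complex_eq_iff 3 2 diff_divide_distrib[symmetric] add_divide_distrib[symmetric])
    qed
  qed
  \<comment> \<open>This serves twice: the value is below 1, which feeds Liouville, and it is
    strictly increasing in the trace p + q, so constancy of \<kappa> fixes the trace first and then
    q - p and r.\<close>
  have \<kappa>_norm: "(norm (\<kappa> z))\<^sup>2 = (p z + q z - 2) / (p z + q z + 2)" for z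
  proof -
    have "(norm (\<kappa> z))\<^sup>2 = ((q z - p z)\<^sup>2 + (2 * r z)\<^sup>2) / (2 + p z + q z)\<^sup>2"
      by (simp add: \<kappa>_def cmod_power2 power_divide add_divide_distrib)
    also have "(q z - p z)\<^sup>2 + (2 * r z)\<^sup>2 = (p z + q z - 2) * (p z + q z + 2)"
      using det[of z] by algebra
    also have "\<dots> / (2 + p z + q z)\<^sup>2 = (p z + q z - 2) / (p z + q z + 2)"
      using pos[of z] qpos[of z] by (simp add: power2_eq_square add.commute add.left_commute)
    finally show ?thesis .
  qed
  have \<kappa>_le: "norm (\<kappa> z) \<le> 1" for z
  proof -
    have "(norm (\<kappa> z))\<^sup>2 \<le> 1"
      unfolding \<kappa>_norm using pos[of z] qpos[of z] by (simp add: divide_le_eq)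
    then show ?thesis by (simp add: power2_le_iff_abs_le abs_square_le_1)
  qed
  have deriv: "deriv (N \<circ> G) = (\<lambda>y. \<kappa> (P (G y)))"
    using w by (auto intro: DERIV_imp_deriv)
  have "(N \<circ> G) holomorphic_on UNIV"
    using w by (auto simp: holomorphic_on_open)
  then have "deriv (N \<circ> G) holomorphic_on UNIV"
    by (rule holomorphic_deriv) simp
  then have "(\<lambda>y. \<kappa> (P (G y))) constant_on UNIV"
    unfolding deriv by (rule Liouville_theorem) (use \<kappa>_le in \<open>blast intro: boundedI\<close>)
  then obtain k where k: "\<And>y. \<kappa> (P (G y)) = k" by (auto simp: constant_on_def)
  have \<kappa>: "\<kappa> z = k" for z
    using k[of "T (Complex (fst z) (snd z))"] by (simp add: GT P_def)
  have s: "p z + q z = p z' + q z'"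
  proof -
    have "(p z + q z - 2) / (p z + q z + 2) = (p z' + q z' - 2) / (p z' + q z' + 2)"
      using \<kappa>_norm[of z] \<kappa>_norm[of z'] by (simp add: \<kappa>)
    then show ?thesis
      using pos[of z] pos[of z'] qpos[of z] qpos[of z'] by (simp add: field_simps)
  qed
  have "\<kappa> z = \<kappa> z'" by (simp add: \<kappa>)
  then have "q z - p z = q z' - p z'" "r z = r z'"
    using s pos[of z'] qpos[of z'] by (auto simp: \<kappa>_def add.assoc)
  with s show ?thesis by simp
qed

section \<open>Curvature in an adapted frame\<close>

lemma vector_real4 [simp]:
  "(vector [x, y, z, w] :: real^4) $ 1 = x" "(vector [x, y, z, w] :: real^4) $ 2 = y"
  "(vector [x, y, z, w] :: real^4) $ 3 = z" "(vector [x, y, z, w] :: real^4) $ 4 = w"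
  unfolding vector_def by simp_all

text \<open>For A with rows (a, b), (c, d) and M with entries e, f, g, the hypotheses say A M A^T =
  I. Hence M^-1 = A^T A, and the conclusions are det M A^T A = adj M and det M (det A)^2 = 1. It is
  used for tangent and for normal frames.\<close>

lemma congruent_identity_2x2:
  fixes a b c d e f g :: real
  assumes "a\<^sup>2 * e + 2 * a * b * f + b\<^sup>2 * g = 1" "c\<^sup>2 * e + 2 * c * d * f + d\<^sup>2 * g = 1"
    "a * c * e + (a * d + b * c) * f + b * d * g = 0"
  shows "(e * g - f\<^sup>2) * (a\<^sup>2 + c\<^sup>2) = g" "(e * g - f\<^sup>2) * (a * b + c * d) = - f"
    "(e * g - f\<^sup>2) * (b\<^sup>2 + d\<^sup>2) = e" "(e * g - f\<^sup>2) * (a * d - b * c)\<^sup>2 = 1"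
proof -
  define D where "D = a * d - b * c"
  have D: "(e * g - f\<^sup>2) * D\<^sup>2 = 1"
    using assms unfolding D_def by algebra
  then show "(e * g - f\<^sup>2) * (a * d - b * c)\<^sup>2 = 1" by (simp add: D_def)
  have D0: "D \<noteq> 0" using D by auto
  have 1: "D * (e * a + f * b) = d" "D * (e * c + f * d) = - b" "D * (f * a + g * b) = - c" "D * (f * c + g * d) = a"
    using assms unfolding D_def by algebra+
  have "D\<^sup>2 * e = b\<^sup>2 + d\<^sup>2" "D\<^sup>2 * g = a\<^sup>2 + c\<^sup>2" "D\<^sup>2 * f = - (a * b + c * d)"
  proof -
    have "D\<^sup>2 * e = d * (D * (e * a + f * b)) - b * (D * (e * c + f * d))"
      "D\<^sup>2 * g = a * (D * (f * c + g * d)) - c * (D * (f * a + g * b))"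
      "D\<^sup>2 * f = d * (D * (f * a + g * b)) - b * (D * (f * c + g * d))"
      by (simp_all add: D_def power2_eq_square algebra_simps)
    then show "D\<^sup>2 * e = b\<^sup>2 + d\<^sup>2" "D\<^sup>2 * g = a\<^sup>2 + c\<^sup>2" "D\<^sup>2 * f = - (a * b + c * d)"
      unfolding 1 by (simp_all add: power2_eq_square)
  qed
  then show "(e * g - f\<^sup>2) * (a\<^sup>2 + c\<^sup>2) = g" "(e * g - f\<^sup>2) * (a * b + c * d) = - f" "(e * g - f\<^sup>2) * (b\<^sup>2 + d\<^sup>2) = e"
    using D by algebra+
qed

section \<open>Metric, Hessians and their frame-independent combinations\<close>

definition metric11 :: "(real \<times> real \<Rightarrow> real \<times> real) \<Rightarrow> real \<times> real \<Rightarrow> real" where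
  "metric11 f p = 1 + (partial 1 (\<lambda>q. fst (f q)) p)\<^sup>2 + (partial 1 (\<lambda>q. snd (f q)) p)\<^sup>2"

definition metric12 :: "(real \<times> real \<Rightarrow> real \<times> real) \<Rightarrow> real \<times> real \<Rightarrow> real" where
  "metric12 f p = partial 1 (\<lambda>q. fst (f q)) p * partial 2 (\<lambda>q. fst (f q)) p
     + partial 1 (\<lambda>q. snd (f q)) p * partial 2 (\<lambda>q. snd (f q)) p"

definition metric22 :: "(real \<times> real \<Rightarrow> real \<times> real) \<Rightarrow> real \<times> real \<Rightarrow> real" where
  "metric22 f p = 1 + (partial 2 (\<lambda>q. fst (f q)) p)\<^sup>2 + (partial 2 (\<lambda>q. snd (f q)) p)\<^sup>2"

definition metric_det :: "(real \<times> real \<Rightarrow> real \<times> real) \<Rightarrow> real \<times> real \<Rightarrow> real" where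
  "metric_det f p = metric11 f p * metric22 f p - (metric12 f p)\<^sup>2"

definition hess :: "(real \<times> real \<Rightarrow> real) \<Rightarrow> real \<times> real \<Rightarrow> real \<times> real \<Rightarrow> real \<times> real \<Rightarrow> real" where
  "hess g p u v = fst u * fst v * partial 1 (partial 1 g) p + fst u * snd v * partial 1 (partial 2 g) p
     + snd u * fst v * partial 2 (partial 1 g) p + snd u * snd v * partial 2 (partial 2 g) p"

text \<open>The polarised Hessian determinant: det Hess g when \<open>h = g\<close> and mixed
  derivatives commute. Its three values on the components of f carry all second-order information
  that the curvatures need.\<close>

definition hess_disc :: "(real \<times> real \<Rightarrow> real) \<Rightarrow> (real \<times> real \<Rightarrow> real) \<Rightarrow> real \<times> real \<Rightarrow> real" where
  "hess_disc g h p = (partial 1 (partial 1 g) p * partial 2 (partial 2 h) p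
     + partial 2 (partial 2 g) p * partial 1 (partial 1 h) p) / 2
     - partial 1 (partial 2 g) p * partial 1 (partial 2 h) p"

lemma inner_real4: "x \<bullet> y = x$1 * y$1 + x$2 * y$2 + x$3 * y$3 + x$4 * (y$4 :: real)" for x y :: "real^4"
  by (simp add: inner_vec_def sum_4)

lemma vector_eq_real4: "x = y \<longleftrightarrow> x$1 = y$1 \<and> x$2 = y$2 \<and> x$3 = y$3 \<and> x$4 = y$4" for x y :: "real^4"
  by (simp add: vec_eq_iff forall_4)

lemma dX_eq: "dX f p u = vector [fst u, snd u,
    fst u * partial 1 (\<lambda>q. fst (f q)) p + snd u * partial 2 (\<lambda>q. fst (f q)) p,
    fst u * partial 1 (\<lambda>q. snd (f q)) p + snd u * partial 2 (\<lambda>q. snd (f q)) p]"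
  by (simp add: dX_def vector_eq_real4 cdir_def)

lemma D2X_eq: "D2X f p u v = vector [0, 0, hess (\<lambda>q. fst (f q)) p u v, hess (\<lambda>q. snd (f q)) p u v]"
  by (simp add: D2X_def vector_eq_real4 hess_def)

text \<open>Cauchy-Binet: the sum of the squared 2x2 minors of the Jacobian of the graph map. The
  expression is unchanged when tangential and normal Gram matrices are exchanged.\<close>

lemma metric_det_eq:
  "metric_det f p = 1 + (partial 1 (\<lambda>q. fst (f q)) p)\<^sup>2 + (partial 1 (\<lambda>q. snd (f q)) p)\<^sup>2
    + (partial 2 (\<lambda>q. fst (f q)) p)\<^sup>2 + (partial 2 (\<lambda>q. snd (f q)) p)\<^sup>2
    + (partial 1 (\<lambda>q. fst (f q)) p * partial 2 (\<lambda>q. snd (f q)) p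
       - partial 2 (\<lambda>q. fst (f q)) p * partial 1 (\<lambda>q. snd (f q)) p)\<^sup>2"
  unfolding metric_det_def metric11_def metric12_def metric22_def by algebra

lemma metric_det_pos: "metric_det f p > 0"
  unfolding metric_det_eq by (intro add_pos_nonneg) auto

lemma metric11_pos: "metric11 f p > 0" and metric22_pos: "metric22 f p > 0"
  by (auto simp: metric11_def metric22_def add_pos_nonneg)

text \<open>A determinant of a bilinear form scales by the square of the change-of-basis
  determinant; polarising preserves this.\<close>

lemma hess_disc_congruence:
  assumes "partial 2 (partial 1 g) p = partial 1 (partial 2 g) p" "partial 2 (partial 1 h) p = partial 1 (partial 2 h) p"
  shows "(hess g p u u * hess h p v v + hess g p v v * hess h p u u) / 2 - hess g p u v * hess h p u v
    = (fst u * snd v - snd u * fst v)\<^sup>2 * hess_disc g h p"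
  unfolding hess_def hess_disc_def assms by (simp add: field_simps power2_eq_square)

lemma hess_commute:
  assumes "partial 2 (partial 1 g) p = partial 1 (partial 2 g) p"
  shows "hess g p u v = hess g p v u"
  unfolding hess_def assms by simp

text \<open>The parameter vectors \<open>u 1\<close>, \<open>u 2\<close> are orthonormal for the
  metric, so the sum of their outer products is the inverse metric. This is how the tangent frame is
  eliminated from the later formulas.\<close>

lemma adapted_frame_tangent:
  assumes "adapted_frame f p u xi"
  defines "s1 \<equiv> fst (u 1)" and "t1 \<equiv> snd (u 1)" and "s2 \<equiv> fst (u 2)" and "t2 \<equiv> snd (u 2)"
  shows "metric_det f p * (s1\<^sup>2 + s2\<^sup>2) = metric22 f p" "metric_det f p * (s1 * t1 + s2 * t2) = - metric12 f p"
    "metric_det f p * (t1\<^sup>2 + t2\<^sup>2) = metric11 f p" "metric_det f p * (s1 * t2 - t1 * s2)\<^sup>2 = 1"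
proof -
  have ip: "dX f p v \<bullet> dX f p w = fst v * fst w * metric11 f p + (fst v * snd w + snd v * fst w) * metric12 f p
      + snd v * snd w * metric22 f p" for v w
    unfolding dX_eq inner_real4 metric11_def metric12_def metric22_def
    by (simp add: algebra_simps power2_eq_square)
  have "frame_vec f p u xi k \<bullet> frame_vec f p u xi l = (if k = l then 1 else 0)" if "k \<in> {1,2}" "l \<in> {1,2}" for k l
    using assms(1) that by (auto simp: adapted_frame_def)
  then have "dX f p (u 1) \<bullet> dX f p (u 1) = 1" "dX f p (u 1) \<bullet> dX f p (u 2) = 0" "dX f p (u 2) \<bullet> dX f p (u 2) = 1"
    by (auto simp: frame_vec_def)
  then have *: "s1\<^sup>2 * metric11 f p + 2 * s1 * t1 * metric12 f p + t1\<^sup>2 * metric22 f p = 1"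
    "s2\<^sup>2 * metric11 f p + 2 * s2 * t2 * metric12 f p + t2\<^sup>2 * metric22 f p = 1"
    "s1 * s2 * metric11 f p + (s1 * t2 + t1 * s2) * metric12 f p + t1 * t2 * metric22 f p = 0"
    unfolding ip s1_def t1_def s2_def t2_def by (simp_all add: power2_eq_square algebra_simps)
  show "metric_det f p * (s1\<^sup>2 + s2\<^sup>2) = metric22 f p" "metric_det f p * (s1 * t1 + s2 * t2) = - metric12 f p"
    "metric_det f p * (t1\<^sup>2 + t2\<^sup>2) = metric11 f p" "metric_det f p * (s1 * t2 - t1 * s2)\<^sup>2 = 1"
    unfolding metric_det_def by (rule congruent_identity_2x2[OF *])+
qed

text \<open>A normal vector is determined by its last two components; in these components the Euclidean product
  is given by the Gram matrix of the normals (- grad f1, 1, 0) and (- grad f2, 0, 1), whose determinant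
  equals that of the metric.\<close>

lemma adapted_frame_normal:
  assumes "adapted_frame f p u xi"
  defines "n11 \<equiv> 1 + (partial 1 (\<lambda>q. fst (f q)) p)\<^sup>2 + (partial 2 (\<lambda>q. fst (f q)) p)\<^sup>2"
    and "n12 \<equiv> partial 1 (\<lambda>q. fst (f q)) p * partial 1 (\<lambda>q. snd (f q)) p
       + partial 2 (\<lambda>q. fst (f q)) p * partial 2 (\<lambda>q. snd (f q)) p"
    and "n22 \<equiv> 1 + (partial 1 (\<lambda>q. snd (f q)) p)\<^sup>2 + (partial 2 (\<lambda>q. snd (f q)) p)\<^sup>2"
    and "a \<equiv> xi 3 $ 3" and "b \<equiv> xi 3 $ 4" and "c \<equiv> xi 4 $ 3" and "d \<equiv> xi 4 $ 4"
  shows "metric_det f p * (a\<^sup>2 + c\<^sup>2) = n22" "metric_det f p * (a * b + c * d) = - n12"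
    "metric_det f p * (b\<^sup>2 + d\<^sup>2) = n11" "metric_det f p * (a * d - b * c)\<^sup>2 = 1"
proof -
  have fr: "frame_vec f p u xi k \<bullet> frame_vec f p u xi l = (if k = l then 1 else 0)" if "k \<in> {1,2,3,4}" "l \<in> {1,2,3,4}" for k l
    using assms(1) that by (auto simp: adapted_frame_def)
  have tan: "dX f p (u 1) \<bullet> x = 0 \<and> dX f p (u 2) \<bullet> x = 0 \<Longrightarrow>
      x$1 = - (partial 1 (\<lambda>q. fst (f q)) p * x$3 + partial 1 (\<lambda>q. snd (f q)) p * x$4) \<and>
      x$2 = - (partial 2 (\<lambda>q. fst (f q)) p * x$3 + partial 2 (\<lambda>q. snd (f q)) p * x$4)" for x
  proof -
    assume "dX f p (u 1) \<bullet> x = 0 \<and> dX f p (u 2) \<bullet> x = 0"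
    \<comment> \<open>\<open>X\<close> and \<open>Y\<close> are the inner products of
      \<open>x\<close> with the two coordinate tangent vectors; a nonsingular combination of them
      vanishes.\<close>
    moreover define X Y where "X = x$1 + (partial 1 (\<lambda>q. fst (f q)) p * x$3 + partial 1 (\<lambda>q. snd (f q)) p * x$4)"
      and "Y = x$2 + (partial 2 (\<lambda>q. fst (f q)) p * x$3 + partial 2 (\<lambda>q. snd (f q)) p * x$4)"
    ultimately have "fst (u 1) * X + snd (u 1) * Y = 0" "fst (u 2) * X + snd (u 2) * Y = 0"
      by (simp_all add: dX_eq inner_real4 algebra_simps)
    then have "(fst (u 1) * snd (u 2) - snd (u 1) * fst (u 2)) * X = 0"
       "(fst (u 1) * snd (u 2) - snd (u 1) * fst (u 2)) * Y = 0"
      by algebra+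
    moreover have "fst (u 1) * snd (u 2) - snd (u 1) * fst (u 2) \<noteq> 0"
      using adapted_frame_tangent(4)[OF assms(1)] by auto
    ultimately have "X = 0" "Y = 0" by auto
    then show ?thesis by (auto simp: X_def Y_def)
  qed
  have "dX f p (u 1) \<bullet> xi 3 = 0 \<and> dX f p (u 2) \<bullet> xi 3 = 0" "dX f p (u 1) \<bullet> xi 4 = 0 \<and> dX f p (u 2) \<bullet> xi 4 = 0"
    using fr[of 1 3] fr[of 2 3] fr[of 1 4] fr[of 2 4] by (simp_all add: frame_vec_def)
  note x = tan[OF this(1)] tan[OF this(2)]
  have "xi 3 \<bullet> xi 3 = 1" "xi 4 \<bullet> xi 4 = 1" "xi 3 \<bullet> xi 4 = 0"
    using fr[of 3 3] fr[of 4 4] fr[of 3 4] by (simp_all add: frame_vec_def)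
  then have *: "a\<^sup>2 * n11 + 2 * a * b * n12 + b\<^sup>2 * n22 = 1" "c\<^sup>2 * n11 + 2 * c * d * n12 + d\<^sup>2 * n22 = 1"
     "a * c * n11 + (a * d + b * c) * n12 + b * d * n22 = 0"
    unfolding inner_real4 n11_def n12_def n22_def a_def b_def c_def d_def
    using x by (simp_all add: power2_eq_square algebra_simps)
  have D: "metric_det f p = n11 * n22 - n12\<^sup>2"
    unfolding metric_det_eq n11_def n12_def n22_def by algebra
  show "metric_det f p * (a\<^sup>2 + c\<^sup>2) = n22" "metric_det f p * (a * b + c * d) = - n12"
    "metric_det f p * (b\<^sup>2 + d\<^sup>2) = n11" "metric_det f p * (a * d - b * c)\<^sup>2 = 1"
    unfolding D by (rule congruent_identity_2x2[OF *])+
qed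

lemma hcoef_eq:
  "hcoef f p u xi \<alpha> i j = - (xi \<alpha> $ 3 * hess (\<lambda>q. fst (f q)) p (u i) (u j) + xi \<alpha> $ 4 * hess (\<lambda>q. snd (f q)) p (u i) (u j))"
  unfolding hcoef_def D2X_eq inner_real4 by simp

text \<open>Vanishing mean curvature is a linear system for the traces of the two component
  Hessians. Its matrix holds the last two entries of the normals and is nonsingular by
  \<open>adapted_frame_normal\<close>, so the components decouple.\<close>

lemma minimal_frame_trace:
  assumes fr: "adapted_frame f p u xi"
    and min: "\<And>\<alpha>. \<alpha> \<in> {3,4} \<Longrightarrow> hcoef f p u xi \<alpha> 1 1 + hcoef f p u xi \<alpha> 2 2 = 0"
  shows "hess (\<lambda>q. fst (f q)) p (u 1) (u 1) + hess (\<lambda>q. fst (f q)) p (u 2) (u 2) = 0"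
    "hess (\<lambda>q. snd (f q)) p (u 1) (u 1) + hess (\<lambda>q. snd (f q)) p (u 2) (u 2) = 0"
proof -
  let ?t1 = "hess (\<lambda>q. fst (f q)) p (u 1) (u 1) + hess (\<lambda>q. fst (f q)) p (u 2) (u 2)"
  let ?t2 = "hess (\<lambda>q. snd (f q)) p (u 1) (u 1) + hess (\<lambda>q. snd (f q)) p (u 2) (u 2)"
  have eq: "xi 3 $ 3 * ?t1 + xi 3 $ 4 * ?t2 = 0" "xi 4 $ 3 * ?t1 + xi 4 $ 4 * ?t2 = 0"
    using min[of 3] min[of 4] by (simp_all add: hcoef_eq algebra_simps)
  have nz: "xi 3 $ 3 * xi 4 $ 4 - xi 3 $ 4 * xi 4 $ 3 \<noteq> 0"
    using adapted_frame_normal(4)[OF fr] by auto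
  have "(xi 3 $ 3 * xi 4 $ 4 - xi 3 $ 4 * xi 4 $ 3) * ?t1 = 0" "(xi 3 $ 3 * xi 4 $ 4 - xi 3 $ 4 * xi 4 $ 3) * ?t2 = 0"
    using eq by algebra+
  with nz show "?t1 = 0" "?t2 = 0" by auto
qed

text \<open>The left side is \<open>metric_det f p\<close> times the trace of the Hessian with
  respect to the metric, computed with the inverse metric from
  \<open>adapted_frame_tangent\<close>.\<close>

lemma minimal_surface_equation:
  assumes fr: "adapted_frame f p u xi"
    and tr: "hess g p (u 1) (u 1) + hess g p (u 2) (u 2) = 0"
    and sym: "partial 2 (partial 1 g) p = partial 1 (partial 2 g) p"
  shows "metric22 f p * partial 1 (partial 1 g) p - 2 * metric12 f p * partial 1 (partial 2 g) p
    + metric11 f p * partial 2 (partial 2 g) p = 0"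
proof -
  have "metric_det f p * (hess g p (u 1) (u 1) + hess g p (u 2) (u 2)) = 0"
    using tr by simp
  then show ?thesis
    using adapted_frame_tangent(1-3)[OF fr] unfolding hess_def sym by algebra
qed

text \<open>The frame enters only through the squared determinant of the tangent pair and through
  quadratic sums of normal components; both are known, so no trace of the frame survives on the
  right.\<close>

lemma gauss_frame_eq:
  assumes fr: "adapted_frame f p u xi"
    and sym: "partial 2 (partial 1 (\<lambda>q. fst (f q))) p = partial 1 (partial 2 (\<lambda>q. fst (f q))) p"
             "partial 2 (partial 1 (\<lambda>q. snd (f q))) p = partial 1 (partial 2 (\<lambda>q. snd (f q))) p"
  shows "(metric_det f p)\<^sup>2 * gauss_frame f p u xi =
    (1 + (partial 1 (\<lambda>q. snd (f q)) p)\<^sup>2 + (partial 2 (\<lambda>q. snd (f q)) p)\<^sup>2) * hess_disc (\<lambda>q. fst (f q)) (\<lambda>q. fst (f q)) p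
    - 2 * (partial 1 (\<lambda>q. fst (f q)) p * partial 1 (\<lambda>q. snd (f q)) p
       + partial 2 (\<lambda>q. fst (f q)) p * partial 2 (\<lambda>q. snd (f q)) p) * hess_disc (\<lambda>q. fst (f q)) (\<lambda>q. snd (f q)) p
    + (1 + (partial 1 (\<lambda>q. fst (f q)) p)\<^sup>2 + (partial 2 (\<lambda>q. fst (f q)) p)\<^sup>2) * hess_disc (\<lambda>q. snd (f q)) (\<lambda>q. snd (f q)) p"
proof -
  let ?f1 = "\<lambda>q. fst (f q)" and ?f2 = "\<lambda>q. snd (f q)"
  define U where "U = (fst (u 1) * snd (u 2) - snd (u 1) * fst (u 2))\<^sup>2"
  have U: "metric_det f p * U = 1"
    using adapted_frame_tangent(4)[OF fr] by (simp add: U_def)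
  note d = hess_disc_congruence[OF sym(1) sym(1), of "u 1" "u 2", folded U_def]
    hess_disc_congruence[OF sym(1) sym(2), of "u 1" "u 2", folded U_def]
    hess_disc_congruence[OF sym(2) sym(2), of "u 1" "u 2", folded U_def]
  have "gauss_frame f p u xi = ((xi 3 $ 3)\<^sup>2 + (xi 4 $ 3)\<^sup>2) * (U * hess_disc ?f1 ?f1 p)
     + 2 * (xi 3 $ 3 * xi 3 $ 4 + xi 4 $ 3 * xi 4 $ 4) * (U * hess_disc ?f1 ?f2 p)
     + ((xi 3 $ 4)\<^sup>2 + (xi 4 $ 4)\<^sup>2) * (U * hess_disc ?f2 ?f2 p)"
    unfolding d[symmetric] by (simp add: gauss_frame_def hcoef_eq field_simps power2_eq_square)
  then have "(metric_det f p)\<^sup>2 * gauss_frame f p u xi =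
     (metric_det f p * U) * ((metric_det f p * ((xi 3 $ 3)\<^sup>2 + (xi 4 $ 3)\<^sup>2)) * hess_disc ?f1 ?f1 p
     + 2 * (metric_det f p * (xi 3 $ 3 * xi 3 $ 4 + xi 4 $ 3 * xi 4 $ 4)) * hess_disc ?f1 ?f2 p
     + (metric_det f p * ((xi 3 $ 4)\<^sup>2 + (xi 4 $ 4)\<^sup>2)) * hess_disc ?f2 ?f2 p)"
    by (simp add: algebra_simps power2_eq_square)
  then show ?thesis
    unfolding U adapted_frame_normal[OF fr] by (simp add: algebra_simps)
qed

text \<open>Squaring removes the frame-dependent sign. For trace-free Hessians
  \<open>normal_frame\<close> is 2 M (a1 b2 - a2 b1), and Lagrange's identity turns the square of
  the bracket into the Gram determinant of (a1, b1) and (a2, b2), which are \<open>hess_disc\<close>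
  values up to the factor \<open>U\<close>.\<close>

lemma normal_frame_square_eq:
  assumes fr: "adapted_frame f p u xi"
    and min: "\<And>\<alpha>. \<alpha> \<in> {3,4} \<Longrightarrow> hcoef f p u xi \<alpha> 1 1 + hcoef f p u xi \<alpha> 2 2 = 0"
    and sym: "partial 2 (partial 1 (\<lambda>q. fst (f q))) p = partial 1 (partial 2 (\<lambda>q. fst (f q))) p"
             "partial 2 (partial 1 (\<lambda>q. snd (f q))) p = partial 1 (partial 2 (\<lambda>q. snd (f q))) p"
  shows "(metric_det f p)^3 * (normal_frame f p u xi)\<^sup>2 =
    4 * (hess_disc (\<lambda>q. fst (f q)) (\<lambda>q. fst (f q)) p * hess_disc (\<lambda>q. snd (f q)) (\<lambda>q. snd (f q)) p
       - (hess_disc (\<lambda>q. fst (f q)) (\<lambda>q. snd (f q)) p)\<^sup>2)"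
proof -
  let ?f1 = "\<lambda>q. fst (f q)" and ?f2 = "\<lambda>q. snd (f q)"
  define U where "U = (fst (u 1) * snd (u 2) - snd (u 1) * fst (u 2))\<^sup>2"
  have U: "metric_det f p * U = 1"
    using adapted_frame_tangent(4)[OF fr] by (simp add: U_def)
  note d = hess_disc_congruence[OF sym(1) sym(1), of "u 1" "u 2", folded U_def]
    hess_disc_congruence[OF sym(1) sym(2), of "u 1" "u 2", folded U_def]
    hess_disc_congruence[OF sym(2) sym(2), of "u 1" "u 2", folded U_def]
  define M where "M = xi 3 $ 3 * xi 4 $ 4 - xi 3 $ 4 * xi 4 $ 3"
  have M: "metric_det f p * M\<^sup>2 = 1"
    using adapted_frame_normal(4)[OF fr] by (simp add: M_def)
  define a1 b1 a2 b2 where "a1 = hess ?f1 p (u 1) (u 1)" and "b1 = hess ?f1 p (u 1) (u 2)"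
    and "a2 = hess ?f2 p (u 1) (u 1)" and "b2 = hess ?f2 p (u 1) (u 2)"
  have tr: "hess ?f1 p (u 2) (u 2) = - a1" "hess ?f2 p (u 2) (u 2) = - a2"
    using minimal_frame_trace[OF fr min] by (simp_all add: a1_def a2_def)
  have sw: "hess ?f1 p (u 2) (u 1) = b1" "hess ?f2 p (u 2) (u 1) = b2"
    using hess_commute sym by (simp_all add: b1_def b2_def)
  have n: "normal_frame f p u xi = 2 * (M * (a1 * b2 - a2 * b1))"
    by (simp add: normal_frame_def hcoef_eq M_def tr sw a1_def[symmetric] b1_def[symmetric]
      a2_def[symmetric] b2_def[symmetric] algebra_simps)
  have d': "U * hess_disc ?f1 ?f1 p = - (a1\<^sup>2 + b1\<^sup>2)" "U * hess_disc ?f1 ?f2 p = - (a1 * a2 + b1 * b2)"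
    "U * hess_disc ?f2 ?f2 p = - (a2\<^sup>2 + b2\<^sup>2)"
    unfolding d[symmetric] tr a1_def[symmetric] b1_def[symmetric] a2_def[symmetric] b2_def[symmetric]
    by (simp_all add: power2_eq_square)
  show ?thesis
    using U M d' unfolding n by algebra
qed

text \<open>Without a frame at \<open>p\<close>, \<open>minimal_graph\<close> would be vacuous there
  and \<open>some_frame\<close> arbitrary. The frame comes from Gram-Schmidt with denominators
  cleared: \<open>v\<close> from the coordinate directions, \<open>y\<close> from the normals (-
  grad f1, 1, 0) and (- grad f2, 0, 1).\<close>

lemma adapted_frame_exists: "\<exists>u xi. adapted_frame f p u xi"
proof -
  define p1 s1 p2 s2 where "p1 = partial 1 (\<lambda>q. fst (f q)) p" and "s1 = partial 2 (\<lambda>q. fst (f q)) p"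
    and "p2 = partial 1 (\<lambda>q. snd (f q)) p" and "s2 = partial 2 (\<lambda>q. snd (f q)) p"
  define e1 n1 where "e1 = 1 + p1\<^sup>2 + p2\<^sup>2" and "n1 = 1 + p1\<^sup>2 + s1\<^sup>2"
  define c m where "c = p1 * s1 + p2 * s2" and "m = p1 * p2 + s1 * s2"
  have pos: "e1 > 0" "n1 > 0"
    by (auto simp: e1_def n1_def add_pos_nonneg)
  define e v :: "real \<times> real" where "e = (1, 0)" and "v = (- c, e1)"
  define y :: "real^4" where "y = vector [p1 * m - p2 * n1, s1 * m - s2 * n1, - m, n1]"
  define x :: "real^4" where "x = vector [- p1, - s1, 1, 0]"
  define u where "u k = (if k = (1::nat) then (1 / norm (dX f p e)) *\<^sub>R e else (1 / norm (dX f p v)) *\<^sub>R v)" for k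
  define xi where "xi k = (if k = (3::nat) then (1 / norm x) *\<^sub>R x else (1 / norm y) *\<^sub>R y)" for k
  have dXs: "dX f p (r *\<^sub>R w) = r *\<^sub>R dX f p w" for r w
    by (simp add: dX_eq vector_eq_real4 algebra_simps)
  have orth: "dX f p e \<bullet> dX f p v = 0" "dX f p e \<bullet> x = 0" "dX f p e \<bullet> y = 0"
    "dX f p v \<bullet> x = 0" "dX f p v \<bullet> y = 0" "x \<bullet> y = 0"
    unfolding dX_eq inner_real4 x_def y_def e_def v_def p1_def[symmetric] s1_def[symmetric] p2_def[symmetric] s2_def[symmetric]
    by (simp_all add: e1_def n1_def c_def m_def algebra_simps power2_eq_square)
  have nz: "dX f p e \<noteq> 0" "dX f p v \<noteq> 0" "x \<noteq> 0" "y \<noteq> 0"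
    using pos by (auto simp: dX_eq x_def y_def e_def v_def vector_eq_real4)
  have unit: "((1 / norm w) *\<^sub>R w) \<bullet> ((1 / norm w) *\<^sub>R w) = 1" if "w \<noteq> 0" for w :: "real^4"
    using that by (simp add: dot_square_norm power2_eq_square)
  have "adapted_frame f p u xi"
    unfolding adapted_frame_def frame_vec_def
    \<comment> \<open>The scaling rules wait for a second pass so that \<open>unit\<close> can first
      match the normalised squares.\<close>
    using orth nz by (simp add: u_def xi_def dXs unit inner_commute del: inner_scaleR_left inner_scaleR_right)
       (simp add: inner_commute)
  then show ?thesis by blast
qed

lemma some_frame_adapted: "adapted_frame f p (fst (some_frame f p)) (snd (some_frame f p))"
  unfolding some_frame_def
  by (rule someI_ex) (use adapted_frame_exists in auto)

section \<open>Minimal graphs\<close>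

lemma iter_partial_snoc: "iter_partial (is @ [i]) g = iter_partial is (partial i g)"
  by (induction "is") auto

lemma smooth2_partial:
  assumes "smooth2 g" "i \<in> {1, 2}"
  shows "smooth2 (partial i g)"
  unfolding smooth2_def
proof (intro allI impI)
  fix "is" :: "nat list" and p
  assume "set is \<subseteq> {1, 2}"
  then have "set (is @ [i]) \<subseteq> {1, 2}" using assms(2) by simp
  then show "iter_partial is (partial i g) differentiable at p"
    using assms(1) unfolding smooth2_def iter_partial_snoc[symmetric] by blast
qed

lemma smooth2_has_derivative:
  assumes "smooth2 g"
  shows "(g has_derivative (\<lambda>h. partial 1 g p * fst h + partial 2 g p * snd h)) (at p)"
proof -
  have "iter_partial [] g differentiable at p"
    using assms unfolding smooth2_def by (metis empty_subsetI list.set(1))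
  then obtain D where D: "(g has_derivative D) (at p)" by (auto simp: differentiable_def)
  interpret D: bounded_linear D by (rule has_derivative_bounded_linear[OF D])
  have part: "partial i g p = D (cdir i)" for i
  proof -
    have "((\<lambda>t. p + t *\<^sub>R cdir i) has_derivative (\<lambda>t. t *\<^sub>R cdir i)) (at 0)"
      by (auto intro!: derivative_eq_intros)
    from has_derivative_compose[OF this] D
    have "((\<lambda>t. g (p + t *\<^sub>R cdir i)) has_derivative (\<lambda>t. D (t *\<^sub>R cdir i))) (at 0)" by simp
    then have "((\<lambda>t. g (p + t *\<^sub>R cdir i)) has_real_derivative D (cdir i)) (at 0)"
      unfolding has_field_derivative_def
      by (rule has_derivative_eq_rhs) (simp add: D.scaleR fun_eq_iff)
    then show ?thesis unfolding partial_def by (rule DERIV_imp_deriv)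
  qed
  have "D = (\<lambda>h. partial 1 g p * fst h + partial 2 g p * snd h)"
  proof (rule ext)
    fix h :: "real \<times> real"
    have "h = fst h *\<^sub>R cdir 1 + snd h *\<^sub>R cdir 2"
      by (simp add: cdir_def prod_eq_iff)
    then have "D h = fst h *\<^sub>R D (cdir 1) + snd h *\<^sub>R D (cdir 2)"
      by (metis D.add D.scaleR)
    then show "D h = partial 1 g p * fst h + partial 2 g p * snd h" by (simp add: part)
  qed
  then show ?thesis using D by simp
qed

lemma smooth2_continuous: "smooth2 g \<Longrightarrow> continuous_on S g"
  using smooth2_has_derivative
  by (meson continuous_at_imp_continuous_on has_derivative_continuous)

lemma smooth2_partial_commute:
  assumes "smooth2 g"
  shows "partial 2 (partial 1 g) p = partial 1 (partial 2 g) p"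
  by (rule mixed_derivatives_eq)
     (auto intro!: smooth2_has_derivative smooth2_continuous smooth2_partial assms)

lemma smooth2_partial_has_derivative:
  assumes "smooth2 g"
  shows "(partial 1 g has_derivative (\<lambda>h. partial 1 (partial 1 g) p * fst h + partial 1 (partial 2 g) p * snd h)) (at p)"
    "(partial 2 g has_derivative (\<lambda>h. partial 1 (partial 2 g) p * fst h + partial 2 (partial 2 g) p * snd h)) (at p)"
  using smooth2_has_derivative[of "partial 1 g" p] smooth2_has_derivative[of "partial 2 g" p]
    smooth2_partial[OF assms] smooth2_partial_commute[OF assms]
  by auto

text \<open>The quotient rule over the common denominator D sqrt D, so that cross derivatives of
  metric entries divided by W can be compared through polynomial numerators.\<close>

lemma has_derivative_divide_sqrt:
  fixes F D :: "real \<times> real \<Rightarrow> real"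
  assumes F: "(F has_derivative (\<lambda>h. a * fst h + b * snd h)) (at z)"
    and D: "(D has_derivative (\<lambda>h. c * fst h + d * snd h)) (at z)" and pos: "D z > 0"
  shows "((\<lambda>z. F z / sqrt (D z)) has_derivative (\<lambda>h. (a * D z - F z * c / 2) / (D z * sqrt (D z)) * fst h
     + (b * D z - F z * d / 2) / (D z * sqrt (D z)) * snd h)) (at z)"
proof -
  have "(sqrt has_derivative (\<lambda>x. x * (inverse (sqrt (D z)) / 2))) (at (D z))"
    using DERIV_real_sqrt[OF pos] unfolding has_field_derivative_def
    by (rule has_derivative_eq_rhs) (simp add: fun_eq_iff)
  from has_derivative_compose[OF D this]
  have "((\<lambda>z. sqrt (D z)) has_derivative (\<lambda>h. (c * fst h + d * snd h) * (inverse (sqrt (D z)) / 2))) (at z)" .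
  moreover obtain s where s: "sqrt (D z) = s" "D z = s\<^sup>2" "s > 0"
    using pos by (metis less_le real_sqrt_gt_zero real_sqrt_pow2)
  ultimately have "((\<lambda>z. F z / sqrt (D z)) has_derivative (\<lambda>h. ((a * fst h + b * snd h) * sqrt (D z)
      - F z * ((c * fst h + d * snd h) * (inverse (sqrt (D z)) / 2))) / (sqrt (D z) * sqrt (D z)))) (at z)"
    by (intro has_derivative_divide'[OF F]) auto
  then show ?thesis
    by (rule has_derivative_eq_rhs)
       (use s in \<open>simp add: fun_eq_iff field_simps power2_eq_square\<close>)
qed

section \<open>The minimal surface system and the conformal class of the metric\<close>

lemma minimal_graph_equation:
  assumes "smooth_map2 f" "minimal_graph f"
  shows "metric22 f p * partial 1 (partial 1 (\<lambda>q. fst (f q))) p - 2 * metric12 f p * partial 1 (partial 2 (\<lambda>q. fst (f q))) p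
      + metric11 f p * partial 2 (partial 2 (\<lambda>q. fst (f q))) p = 0"
    "metric22 f p * partial 1 (partial 1 (\<lambda>q. snd (f q))) p - 2 * metric12 f p * partial 1 (partial 2 (\<lambda>q. snd (f q))) p
      + metric11 f p * partial 2 (partial 2 (\<lambda>q. snd (f q))) p = 0"
proof -
  obtain u xi where fr: "adapted_frame f p u xi" using adapted_frame_exists by blast
  then have min: "\<And>\<alpha>. \<alpha> \<in> {3,4} \<Longrightarrow> hcoef f p u xi \<alpha> 1 1 + hcoef f p u xi \<alpha> 2 2 = 0"
    using assms(2) unfolding minimal_graph_def by blast
  have sm: "smooth2 (\<lambda>q. fst (f q))" "smooth2 (\<lambda>q. snd (f q))"
    using assms(1) by (auto simp: smooth_map2_def)
  show "metric22 f p * partial 1 (partial 1 (\<lambda>q. fst (f q))) p - 2 * metric12 f p * partial 1 (partial 2 (\<lambda>q. fst (f q))) p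
      + metric11 f p * partial 2 (partial 2 (\<lambda>q. fst (f q))) p = 0"
    by (rule minimal_surface_equation[OF fr minimal_frame_trace(1)[OF fr min] smooth2_partial_commute[OF sm(1)]])
  show "metric22 f p * partial 1 (partial 1 (\<lambda>q. snd (f q))) p - 2 * metric12 f p * partial 1 (partial 2 (\<lambda>q. snd (f q))) p
      + metric11 f p * partial 2 (partial 2 (\<lambda>q. snd (f q))) p = 0"
    by (rule minimal_surface_equation[OF fr minimal_frame_trace(2)[OF fr min] smooth2_partial_commute[OF sm(2)]])
qed

lemma minimal_graph_metric_conformally_constant:
  assumes sm: "smooth_map2 f" and min: "minimal_graph f"
  obtains P R Q :: real where "P > 0" "Q > 0" "P * Q - R\<^sup>2 = 1"
    "\<And>z. metric11 f z = P * sqrt (metric_det f z)" "\<And>z. metric12 f z = R * sqrt (metric_det f z)"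
    "\<And>z. metric22 f z = Q * sqrt (metric_det f z)"
proof -
  define f1 f2 where "f1 = (\<lambda>q. fst (f q))" and "f2 = (\<lambda>q. snd (f q))"
  have sm12: "smooth2 f1" "smooth2 f2" using sm by (auto simp: smooth_map2_def f1_def f2_def)
  define p1 s1 p2 s2 where "p1 = partial 1 f1" and "s1 = partial 2 f1" and "p2 = partial 1 f2" and "s2 = partial 2 f2"
  define a1 b1 c1 where "a1 = partial 1 (partial 1 f1)" and "b1 = partial 1 (partial 2 f1)" and "c1 = partial 2 (partial 2 f1)"
  define a2 b2 c2 where "a2 = partial 1 (partial 1 f2)" and "b2 = partial 1 (partial 2 f2)" and "c2 = partial 2 (partial 2 f2)"
  define E F G D where "E = metric11 f" and "F = metric12 f" and "G = metric22 f" and "D = metric_det f"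
  note defs = p1_def s1_def p2_def s2_def a1_def b1_def c1_def a2_def b2_def c2_def
  have d: "(p1 has_derivative (\<lambda>h. a1 z * fst h + b1 z * snd h)) (at z)"
      "(s1 has_derivative (\<lambda>h. b1 z * fst h + c1 z * snd h)) (at z)"
      "(p2 has_derivative (\<lambda>h. a2 z * fst h + b2 z * snd h)) (at z)"
      "(s2 has_derivative (\<lambda>h. b2 z * fst h + c2 z * snd h)) (at z)" for z
    unfolding defs using smooth2_partial_has_derivative sm12 by blast+
  have cont: "continuous_on UNIV p1" "continuous_on UNIV s1" "continuous_on UNIV p2" "continuous_on UNIV s2"
      "continuous_on UNIV a1" "continuous_on UNIV b1" "continuous_on UNIV c1"
      "continuous_on UNIV a2" "continuous_on UNIV b2" "continuous_on UNIV c2"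
    unfolding defs using sm12 by (auto intro!: smooth2_continuous smooth2_partial)
  have E: "E = (\<lambda>z. 1 + (p1 z)\<^sup>2 + (p2 z)\<^sup>2)" and F: "F = (\<lambda>z. p1 z * s1 z + p2 z * s2 z)"
    and G: "G = (\<lambda>z. 1 + (s1 z)\<^sup>2 + (s2 z)\<^sup>2)" and D: "D = (\<lambda>z. E z * G z - (F z)\<^sup>2)"
    by (auto simp: fun_eq_iff E_def F_def G_def D_def metric11_def metric12_def metric22_def metric_det_def
        p1_def s1_def p2_def s2_def f1_def f2_def)
  define Ex Ey Fx Fy Gx Gy where "Ex z = 2 * (p1 z * a1 z + p2 z * a2 z)" and "Ey z = 2 * (p1 z * b1 z + p2 z * b2 z)"
    and "Fx z = a1 z * s1 z + p1 z * b1 z + (a2 z * s2 z + p2 z * b2 z)"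
    and "Fy z = b1 z * s1 z + p1 z * c1 z + (b2 z * s2 z + p2 z * c2 z)"
    and "Gx z = 2 * (s1 z * b1 z + s2 z * b2 z)" and "Gy z = 2 * (s1 z * c1 z + s2 z * c2 z)" for z
  define Dx Dy where "Dx z = Ex z * G z + E z * Gx z - 2 * F z * Fx z"
    and "Dy z = Ey z * G z + E z * Gy z - 2 * F z * Fy z" for z
  have Ed: "(E has_derivative (\<lambda>h. Ex z * fst h + Ey z * snd h)) (at z)"
    and Fd: "(F has_derivative (\<lambda>h. Fx z * fst h + Fy z * snd h)) (at z)"
    and Gd: "(G has_derivative (\<lambda>h. Gx z * fst h + Gy z * snd h)) (at z)" for z
    unfolding E F G Ex_def Ey_def Fx_def Fy_def Gx_def Gy_def
    by (rule has_derivative_eq_rhs, (rule d derivative_intros)+, simp add: fun_eq_iff algebra_simps)+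
  have Dd: "(D has_derivative (\<lambda>h. Dx z * fst h + Dy z * snd h)) (at z)" for z
    unfolding D Dx_def Dy_def
    by (rule has_derivative_eq_rhs, (rule Ed Fd Gd derivative_intros)+, simp add: fun_eq_iff algebra_simps)
  have Dpos: "D z > 0" for z by (simp add: D_def metric_det_pos)
  define p r q where "p z = E z / sqrt (D z)" and "r z = F z / sqrt (D z)" and "q z = G z / sqrt (D z)" for z
  define px m1 m2 qy where "px z = (Ex z * D z - E z * Dx z / 2) / (D z * sqrt (D z))"
    and "m1 z = (Ey z * D z - E z * Dy z / 2) / (D z * sqrt (D z))"
    and "m2 z = (Fy z * D z - F z * Dy z / 2) / (D z * sqrt (D z))"
    and "qy z = (Gy z * D z - G z * Dy z / 2) / (D z * sqrt (D z))" for z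
  have pde: "G z * a1 z - 2 * F z * b1 z + E z * c1 z = 0" "G z * a2 z - 2 * F z * b2 z + E z * c2 z = 0" for z
    using minimal_graph_equation[OF sm min, of z]
    by (simp_all add: E_def F_def G_def defs f1_def f2_def)
  \<comment> \<open>\<open>m1\<close> and \<open>m2\<close> were defined as the y-derivatives of
    \<open>p\<close> and \<open>r\<close>. This identity and its companion below show that they are
    also the x-derivatives of \<open>r\<close> and \<open>q\<close>: the discrepancy is a
    combination of the two vanishing expressions in \<open>pde\<close>.\<close>
  have "(Fx z * D z - F z * Dx z / 2) - (Ey z * D z - E z * Dy z / 2)
      = E z * (s1 z * (G z * a1 z - 2 * F z * b1 z + E z * c1 z) + s2 z * (G z * a2 z - 2 * F z * b2 z + E z * c2 z))
      - F z * (p1 z * (G z * a1 z - 2 * F z * b1 z + E z * c1 z) + p2 z * (G z * a2 z - 2 * F z * b2 z + E z * c2 z))" for z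
    unfolding D Dx_def Dy_def unfolding Ex_def Ey_def Fx_def Fy_def Gx_def Gy_def
    by (simp add: field_simps power2_eq_square)
  then have m1: "m1 z = (Fx z * D z - F z * Dx z / 2) / (D z * sqrt (D z))" for z
    by (simp add: pde m1_def)
  have "(Fy z * D z - F z * Dy z / 2) - (Gx z * D z - G z * Dx z / 2)
      = G z * (p1 z * (G z * a1 z - 2 * F z * b1 z + E z * c1 z) + p2 z * (G z * a2 z - 2 * F z * b2 z + E z * c2 z))
      - F z * (s1 z * (G z * a1 z - 2 * F z * b1 z + E z * c1 z) + s2 z * (G z * a2 z - 2 * F z * b2 z + E z * c2 z))" for z
    unfolding D Dx_def Dy_def unfolding Ex_def Ey_def Fx_def Fy_def Gx_def Gy_def
    by (simp add: field_simps power2_eq_square)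
  then have m2: "m2 z = (Gx z * D z - G z * Dx z / 2) / (D z * sqrt (D z))" for z
    by (simp add: pde m2_def)
  have const: "p z = p z' \<and> r z = r z' \<and> q z = q z'" for z z'
  proof (rule unimodular_hessian_constant)
    show "(p has_derivative (\<lambda>h. px z * fst h + m1 z * snd h)) (at z)" for z
      unfolding p_def[abs_def] px_def m1_def by (rule has_derivative_divide_sqrt[OF Ed Dd Dpos])
    show "(r has_derivative (\<lambda>h. m1 z * fst h + m2 z * snd h)) (at z)" for z
      unfolding r_def[abs_def] m1 m2_def by (rule has_derivative_divide_sqrt[OF Fd Dd Dpos])
    show "(q has_derivative (\<lambda>h. m2 z * fst h + qy z * snd h)) (at z)" for z
      unfolding q_def[abs_def] m2 qy_def by (rule has_derivative_divide_sqrt[OF Gd Dd Dpos])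
    have cE: "continuous_on UNIV E" "continuous_on UNIV F" "continuous_on UNIV G"
      unfolding E F G by (intro continuous_intros cont)+
    have cEx: "continuous_on UNIV Ex" "continuous_on UNIV Ey" "continuous_on UNIV Fx"
      "continuous_on UNIV Fy" "continuous_on UNIV Gx" "continuous_on UNIV Gy"
      unfolding Ex_def[abs_def] Ey_def[abs_def] Fx_def[abs_def] Fy_def[abs_def] Gx_def[abs_def] Gy_def[abs_def]
      by (intro continuous_intros cont)+
    have cD: "continuous_on UNIV D" "continuous_on UNIV Dx" "continuous_on UNIV Dy"
      unfolding D Dx_def[abs_def] Dy_def[abs_def] by (intro continuous_intros cE cEx)+
    have nz: "D z * sqrt (D z) \<noteq> 0" for z using Dpos[of z] by simp
    show "continuous_on UNIV px" "continuous_on UNIV m1" "continuous_on UNIV m2" "continuous_on UNIV qy"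
      unfolding px_def[abs_def] m1_def[abs_def] m2_def[abs_def] qy_def[abs_def]
      by (intro continuous_intros cE cEx cD ballI nz; simp)+
    show "p z * q z - (r z)\<^sup>2 = 1" for z
      using Dpos[of z] unfolding p_def q_def r_def
      by (simp add: power_divide diff_divide_distrib[symmetric]) (simp add: D power2_eq_square)
    show "p z > 0" for z
      using Dpos[of z] by (simp add: p_def E_def metric11_pos)
  qed
  let ?o = "(0, 0) :: real \<times> real"
  show thesis
  proof (rule that[of "p ?o" "q ?o" "r ?o"])
    show "p ?o > 0" "q ?o > 0"
      using Dpos[of ?o] by (simp_all add: p_def q_def E_def G_def metric11_pos metric22_pos)
    show "p ?o * q ?o - (r ?o)\<^sup>2 = 1"
      using Dpos[of ?o] unfolding p_def q_def r_def
      by (simp add: power_divide diff_divide_distrib[symmetric]) (simp add: D power2_eq_square)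
    show "metric11 f z = p ?o * sqrt (metric_det f z)" "metric12 f z = r ?o * sqrt (metric_det f z)"
      "metric22 f z = q ?o * sqrt (metric_det f z)" for z
      using const[of ?o z] Dpos[of z] by (simp_all add: p_def[of z] q_def[of z] r_def[of z] E_def F_def G_def D_def)
  qed
qed

section \<open>Isothermal parameters\<close>

lemma entire_product_zero:
  assumes f: "f holomorphic_on UNIV" and g: "g holomorphic_on UNIV" and fg: "\<And>z. f z * g z = (0::complex)"
  shows "(\<forall>z. f z = 0) \<or> (\<forall>z. g z = 0)"
proof (rule ccontr)
  assume "\<not> ?thesis"
  then obtain z1 z2 where z: "f z1 \<noteq> 0" "g z2 \<noteq> 0" by blast
  have "continuous_on UNIV f" using f by (rule holomorphic_on_imp_continuous_on)
  then have op: "open {z. f z \<noteq> 0}"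
    by (intro open_Collect_neq) auto
  have "g z2 = 0"
    by (rule analytic_continuation_open[of "{z. f z \<noteq> 0}" UNIV g "\<lambda>_. 0"])
       (use op z(1) g fg in \<open>auto simp: connected_UNIV\<close>)
  with z(2) show False by simp
qed

text \<open>If the moduli never met, connectedness would make one of them the smaller everywhere;
  its square then stays below \<open>norm e\<close>, and Liouville makes that factor, hence both,
  constant.\<close>

lemma entire_reciprocal_norms_meet:
  fixes f g :: "complex \<Rightarrow> complex"
  assumes f: "f holomorphic_on UNIV" and g: "g holomorphic_on UNIV" and fg: "\<And>z. f z * g z = e"
    and e: "e \<noteq> 0" and nc: "\<not> f constant_on UNIV"
  obtains z where "norm (f z) = norm (g z)"
proof (rule ccontr)
  assume "\<not> thesis"
  then have ne: "norm (f z) \<noteq> norm (g z)" for z using that by blast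
  have cont: "continuous_on UNIV (\<lambda>z. norm (f z) - norm (g z))"
    by (intro continuous_intros holomorphic_on_imp_continuous_on f g)
  have bdd: "h constant_on UNIV" if h: "h holomorphic_on UNIV" and less: "\<And>z. norm (h z) < norm (k z)" and hk: "\<And>z. h z * k z = e" for h k :: "complex \<Rightarrow> complex"
  proof (rule Liouville_theorem[OF h])
    \<comment> \<open>The bound \<open>norm e + 1\<close> avoids a square root: its square dominates
      \<open>norm e\<close>.\<close>
    have "norm (h z) \<le> norm e + 1" for z
    proof -
      have "(norm (h z))\<^sup>2 \<le> norm (h z) * norm (k z)"
        unfolding power2_eq_square using less[of z] by (intro mult_left_mono) auto
      also have "\<dots> = norm e" by (metis hk norm_mult)
      also have "\<dots> \<le> (norm e + 1)\<^sup>2" by (simp add: power2_eq_square algebra_simps)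
      finally show ?thesis by (rule power2_le_imp_le) simp
    qed
    then show "bounded (range h)" by (blast intro: boundedI)
  qed
  have conn: "connected (range (\<lambda>z. norm (f z) - norm (g z)))"
    by (intro connected_continuous_image cont connected_UNIV)
  have "(\<forall>z. norm (f z) < norm (g z)) \<or> (\<forall>z. norm (g z) < norm (f z))"
  proof (rule ccontr)
    assume "\<not> ?thesis"
    then obtain z1 z2 where "norm (f z1) - norm (g z1) \<ge> 0" "norm (f z2) - norm (g z2) \<le> 0"
      by (auto simp: not_less)
    then have "0 \<in> range (\<lambda>z. norm (f z) - norm (g z))"
      by (intro connectedD_interval[OF conn rangeI rangeI])
    then obtain z where "0 = norm (f z) - norm (g z)" by blast
    then show False using ne[of z] by simp
  qed
  then show False
  proof
    assume "\<forall>z. norm (f z) < norm (g z)"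
    then have "f constant_on UNIV" by (intro bdd[OF f _ fg]) auto
    with nc show False by blast
  next
    assume "\<forall>z. norm (g z) < norm (f z)"
    then have "g constant_on UNIV" using fg by (intro bdd[OF g, of f]) (auto simp: mult.commute)
    then obtain c where c: "\<And>z. g z = c" by (auto simp: constant_on_def)
    then have "f z = e / c" for z using fg[of z] e by (auto simp: field_simps)
    then have "f constant_on UNIV" by (auto simp: constant_on_def)
    with nc show False by blast
  qed
qed

text \<open>The coordinate w = x + i(Rx + Qy) is isothermal for the flat metric
  P dx^2 + 2R dx dy + Q dy^2 when PQ - R^2 = 1, and \<open>isothermal_point\<close> recovers (x, y) from it. In terms
  of w, \<open>isothermal_grad\<close> is twice the Wirtinger derivative of g, and \<open>isothermal_hess\<close> is the complex
  derivative of \<open>isothermal_grad\<close> when g is harmonic for this metric.\<close>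

definition isothermal_point :: "real \<Rightarrow> real \<Rightarrow> complex \<Rightarrow> real \<times> real" where
  "isothermal_point R Q w = (Re w, (Im w - R * Re w) / Q)"

definition isothermal_grad :: "real \<Rightarrow> real \<Rightarrow> (real \<times> real \<Rightarrow> real) \<Rightarrow> complex \<Rightarrow> complex" where
  "isothermal_grad R Q g w = of_real (partial 1 g (isothermal_point R Q w))
     - Complex (R / Q) (1 / Q) * of_real (partial 2 g (isothermal_point R Q w))"

definition isothermal_hess :: "real \<Rightarrow> real \<Rightarrow> (real \<times> real \<Rightarrow> real) \<Rightarrow> real \<times> real \<Rightarrow> complex" where
  "isothermal_hess R Q g p = - Complex (partial 2 (partial 2 g) p / Q\<^sup>2)
     ((Q * partial 1 (partial 2 g) p - R * partial 2 (partial 2 g) p) / Q\<^sup>2)"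

lemma isothermal_point_surj:
  assumes "Q \<noteq> 0"
  obtains w where "p = isothermal_point R Q w"
proof
  show "p = isothermal_point R Q (Complex (fst p) (R * fst p + Q * snd p))"
    using assms by (simp add: isothermal_point_def)
qed

lemma isothermal_grad_derivative:
  assumes g: "smooth2 g" and PQ: "P * Q - R\<^sup>2 = 1" and Q: "Q \<noteq> 0"
    and eq: "\<And>p. Q * partial 1 (partial 1 g) p - 2 * R * partial 1 (partial 2 g) p + P * partial 2 (partial 2 g) p = 0"
  shows "(isothermal_grad R Q g has_field_derivative isothermal_hess R Q g (isothermal_point R Q w)) (at w)"
proof -
  define a b c where "a = partial 1 (partial 1 g) (isothermal_point R Q w)"
    and "b = partial 1 (partial 2 g) (isothermal_point R Q w)" and "c = partial 2 (partial 2 g) (isothermal_point R Q w)"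
  have abc: "Q * a = 2 * R * b - P * c" "P * Q = R\<^sup>2 + 1"
    using eq[of "isothermal_point R Q w"] PQ by (simp_all add: a_def b_def c_def)
  have L: "(isothermal_point R Q has_derivative (\<lambda>h. (Re h, (Im h - R * Re h) / Q))) (at w)"
    unfolding isothermal_point_def[abs_def] using Q by (auto intro!: derivative_eq_intros simp: fun_eq_iff)
  have d: "((\<lambda>w. partial 1 g (isothermal_point R Q w)) has_derivative (\<lambda>h. a * Re h + b * ((Im h - R * Re h) / Q))) (at w)"
    "((\<lambda>w. partial 2 g (isothermal_point R Q w)) has_derivative (\<lambda>h. b * Re h + c * ((Im h - R * Re h) / Q))) (at w)"
    using has_derivative_compose[OF L smooth2_partial_has_derivative(1)[OF g]]
      has_derivative_compose[OF L smooth2_partial_has_derivative(2)[OF g]]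
    by (simp_all add: a_def b_def c_def)
  have "(isothermal_grad R Q g has_derivative
      (\<lambda>h. of_real (a * Re h + b * ((Im h - R * Re h) / Q))
         - Complex (R / Q) (1 / Q) * of_real (b * Re h + c * ((Im h - R * Re h) / Q)))) (at w)"
    unfolding isothermal_grad_def[abs_def]
    by (intro has_derivative_diff has_derivative_mult_right has_derivative_of_real d)
  then show ?thesis
    unfolding has_field_derivative_def
  proof (rule has_derivative_eq_rhs)
    have "Q\<^sup>2 * a = 2 * R * b * Q - (R\<^sup>2 + 1) * c"
      using abc by algebra
    then have a: "a = (2 * R * b * Q - (R\<^sup>2 + 1) * c) / Q\<^sup>2"
      using Q by (simp add: field_simps)
    show "(\<lambda>h. of_real (a * Re h + b * ((Im h - R * Re h) / Q))
         - Complex (R / Q) (1 / Q) * of_real (b * Re h + c * ((Im h - R * Re h) / Q)))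
      = (*) (isothermal_hess R Q g (isothermal_point R Q w))"
      unfolding isothermal_hess_def b_def[symmetric] c_def[symmetric] a
      using Q by (simp add: fun_eq_iff complex_eq_iff field_simps power2_eq_square)
  qed
qed

text \<open>In an isothermal coordinate the Hessian determinant of a harmonic function is minus the
  squared modulus of the complex derivative of its gradient; this is the polarised form. The factor
  Q^2 is the squared Jacobian of w with respect to (x, y).\<close>

lemma hess_disc_isothermal:
  assumes PQ: "P * Q - R\<^sup>2 = 1" and Q: "Q \<noteq> 0"
    and eq: "Q * partial 1 (partial 1 g) p - 2 * R * partial 1 (partial 2 g) p + P * partial 2 (partial 2 g) p = 0"
      "Q * partial 1 (partial 1 h) p - 2 * R * partial 1 (partial 2 h) p + P * partial 2 (partial 2 h) p = 0"
  shows "hess_disc g h p = - (Q\<^sup>2 * Re (isothermal_hess R Q g p * cnj (isothermal_hess R Q h p)))"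
proof -
  have P: "P = (R\<^sup>2 + 1) / Q" using PQ Q by (simp add: field_simps)
  have a: "partial 1 (partial 1 g) p = (2 * R * partial 1 (partial 2 g) p - P * partial 2 (partial 2 g) p) / Q"
    "partial 1 (partial 1 h) p = (2 * R * partial 1 (partial 2 h) p - P * partial 2 (partial 2 h) p) / Q"
    using eq Q by (simp_all add: field_simps)
  show ?thesis
    unfolding hess_disc_def isothermal_hess_def a P
    using Q by (simp add: field_simps power2_eq_square)
qed

lemma curvature_isothermal:
  fixes X Y :: complex
  assumes sm: "smooth_map2 f" and min: "minimal_graph f"
    and d: "hess_disc (\<lambda>q. fst (f q)) (\<lambda>q. fst (f q)) p = - (Q\<^sup>2 * Re (X * cnj X))"
      "hess_disc (\<lambda>q. fst (f q)) (\<lambda>q. snd (f q)) p = - (Q\<^sup>2 * Re (X * cnj Y))"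
      "hess_disc (\<lambda>q. snd (f q)) (\<lambda>q. snd (f q)) p = - (Q\<^sup>2 * Re (Y * cnj Y))"
  shows "X = 0 \<Longrightarrow> Y = 0 \<Longrightarrow> gauss_curv f p = 0"
    "(metric_det f p)\<^sup>2 * gauss_curv f p \<le> - (Q\<^sup>2 * ((norm X)\<^sup>2 + (norm Y)\<^sup>2))"
    "sqrt (metric_det f p) ^ 3 * \<bar>normal_curv f p\<bar> = 2 * Q\<^sup>2 * \<bar>Im (X * cnj Y)\<bar>"
proof -
  have sm12: "smooth2 (\<lambda>q. fst (f q))" "smooth2 (\<lambda>q. snd (f q))"
    using sm by (auto simp: smooth_map2_def)
  note sym = smooth2_partial_commute[OF sm12(1)] smooth2_partial_commute[OF sm12(2)]
  have fmin: "\<alpha> \<in> {3,4} \<Longrightarrow> hcoef f p (fst (some_frame f p)) (snd (some_frame f p)) \<alpha> 1 1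
      + hcoef f p (fst (some_frame f p)) (snd (some_frame f p)) \<alpha> 2 2 = 0" for \<alpha>
    using min some_frame_adapted unfolding minimal_graph_def by blast
  define u1 u2 v1 v2 where "u1 = partial 1 (\<lambda>q. fst (f q)) p" and "u2 = partial 1 (\<lambda>q. snd (f q)) p"
    and "v1 = partial 2 (\<lambda>q. fst (f q)) p" and "v2 = partial 2 (\<lambda>q. snd (f q)) p"
  note K = gauss_frame_eq[OF some_frame_adapted[of f p] sym, folded gauss_curv_def, unfolded d, folded u1_def u2_def v1_def v2_def]
  have D: "metric_det f p > 0" by (rule metric_det_pos)
  show "gauss_curv f p = 0" if "X = 0" "Y = 0"
    using K D by (simp add: that)
  \<comment> \<open>The terms with first derivatives complete to squared norms, so discarding them
    leaves an upper bound for the curvature.\<close>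
  have "(metric_det f p)\<^sup>2 * gauss_curv f p = - (Q\<^sup>2 * ((norm X)\<^sup>2 + (norm Y)\<^sup>2
      + (norm (of_real u2 * X - of_real u1 * Y))\<^sup>2 + (norm (of_real v2 * X - of_real v1 * Y))\<^sup>2))"
    unfolding K cmod_power2 by (simp add: power2_eq_square algebra_simps)
  also have "\<dots> \<le> - (Q\<^sup>2 * ((norm X)\<^sup>2 + (norm Y)\<^sup>2))"
    by (simp add: mult_left_mono)
  finally show "(metric_det f p)\<^sup>2 * gauss_curv f p \<le> - (Q\<^sup>2 * ((norm X)\<^sup>2 + (norm Y)\<^sup>2))" .
  have N: "metric_det f p ^ 3 * (normal_curv f p)\<^sup>2
      = 4 * (Q\<^sup>2 * Re (X * cnj X) * (Q\<^sup>2 * Re (Y * cnj Y)) - (Q\<^sup>2 * Re (X * cnj Y))\<^sup>2)"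
    using normal_frame_square_eq[OF some_frame_adapted[of f p] fmin sym] unfolding normal_curv_def d by simp
  have "(sqrt (metric_det f p) ^ 3 * \<bar>normal_curv f p\<bar>)\<^sup>2 = (sqrt (metric_det f p) ^ 2) ^ 3 * (normal_curv f p)\<^sup>2"
    by (simp add: power_mult_distrib power_mult[symmetric] mult.commute)
  also have "\<dots> = (metric_det f p) ^ 3 * (normal_curv f p)\<^sup>2"
    using D by simp
  \<comment> \<open>Lagrange's identity: |X|^2 |Y|^2 - (Re (X cnj Y))^2 = (Im (X cnj Y))^2.\<close>
  also have "\<dots> = (2 * Q\<^sup>2 * \<bar>Im (X * cnj Y)\<bar>)\<^sup>2"
    unfolding N by (simp add: power_mult_distrib) algebra
  finally show "sqrt (metric_det f p) ^ 3 * \<bar>normal_curv f p\<bar> = 2 * Q\<^sup>2 * \<bar>Im (X * cnj Y)\<bar>"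
    by (rule power2_eq_imp_eq) (use D in auto)
qed

text \<open>With W = sqrt D, the bound for K carries W^4 and the formula for N carries W^3, which
  leaves one factor W. The remaining ratio 2 |Im (X cnj Y)| / (|X|^2 + |Y|^2) becomes a difference
  over a sum when rewritten in X + iY and X - iY.\<close>

lemma curvature_ratio_le:
  fixes X Y :: complex and D K N Q :: real
  assumes D: "D > 0" and Q: "Q > 0" and XY: "X \<noteq> 0 \<or> Y \<noteq> 0"
    and K: "D\<^sup>2 * K \<le> - (Q\<^sup>2 * ((norm X)\<^sup>2 + (norm Y)\<^sup>2))"
    and N: "sqrt D ^ 3 * \<bar>N\<bar> = 2 * Q\<^sup>2 * \<bar>Im (X * cnj Y)\<bar>"
  shows "K < 0" "\<bar>N\<bar> / \<bar>K\<bar> \<le> sqrt D * (\<bar>(norm (X + \<i> * Y))\<^sup>2 - (norm (X - \<i> * Y))\<^sup>2\<bar>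
      / ((norm (X + \<i> * Y))\<^sup>2 + (norm (X - \<i> * Y))\<^sup>2))"
proof -
  define s where "s = sqrt D"
  have s: "s > 0" "D = s\<^sup>2" using D by (simp_all add: s_def)
  define S I where "S = (norm X)\<^sup>2 + (norm Y)\<^sup>2" and "I = \<bar>Im (X * cnj Y)\<bar>"
  have S: "S > 0" using XY unfolding S_def by (metis add_nonneg_pos add_pos_nonneg zero_le_power2 zero_less_norm_iff zero_less_power)
  have "D\<^sup>2 * K < 0"
    using K S Q unfolding S_def[symmetric] by (smt (verit) mult_pos_pos zero_less_power)
  then show K0: "K < 0" using D by (simp add: mult_less_0_iff)
  have sums: "(norm (X + \<i> * Y))\<^sup>2 - (norm (X - \<i> * Y))\<^sup>2 = 4 * Im (X * cnj Y)"
    "(norm (X + \<i> * Y))\<^sup>2 + (norm (X - \<i> * Y))\<^sup>2 = 2 * S"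
    unfolding cmod_power2 S_def by (simp_all add: power2_eq_square algebra_simps)
  have K': "Q\<^sup>2 * S \<le> s ^ 4 * \<bar>K\<bar>"
    using K K0 unfolding S_def[symmetric] by (simp add: s(2) power_mult[symmetric])
  have N': "s ^ 3 * \<bar>N\<bar> = 2 * Q\<^sup>2 * I"
    using N by (simp add: s_def I_def)
  have "(s ^ 3 * S) * \<bar>N\<bar> = 2 * I * (Q\<^sup>2 * S)"
    using N' by algebra
  also have "\<dots> \<le> 2 * I * (s ^ 4 * \<bar>K\<bar>)"
    using K' by (intro mult_left_mono) (auto simp: I_def)
  also have "\<dots> = (s ^ 3 * S) * (s * (2 * I / S) * \<bar>K\<bar>)"
  proof -
    have "S * (2 * I / S) = 2 * I" using S by simp
    then show ?thesis by algebra
  qed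
  finally have "\<bar>N\<bar> \<le> s * (2 * I / S) * \<bar>K\<bar>"
    by (rule mult_left_le_imp_le) (use s S in simp)
  then have "\<bar>N\<bar> / \<bar>K\<bar> \<le> s * (2 * I / S)"
    using K0 by (subst pos_divide_le_eq) auto
  also have "2 * I / S = \<bar>4 * Im (X * cnj Y)\<bar> / (2 * S)"
    unfolding I_def abs_mult by simp
  finally show "\<bar>N\<bar> / \<bar>K\<bar> \<le> sqrt D * (\<bar>(norm (X + \<i> * Y))\<^sup>2 - (norm (X - \<i> * Y))\<^sup>2\<bar>
      / ((norm (X + \<i> * Y))\<^sup>2 + (norm (X - \<i> * Y))\<^sup>2))"
    unfolding sums s_def .
qed

text \<open>The guard on nonemptiness is there because a real infimum over the empty set carries no
  information; it concerns graphs without negative curvature, such as planes.\<close>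

theorem theorem1p2:
  fixes f :: "real \<times> real \<Rightarrow> real \<times> real"
  assumes "smooth_map2 f"
    and "minimal_graph f"
  shows "complex_analytic_graph f \<or>
         ({p. gauss_curv f p < 0} \<noteq> {} \<longrightarrow>
          Inf ((\<lambda>p. \<bar>normal_curv f p\<bar> / \<bar>gauss_curv f p\<bar>) ` {p. gauss_curv f p < 0}) = 0)"
proof -
  define f1 f2 where "f1 = (\<lambda>q. fst (f q))" and "f2 = (\<lambda>q. snd (f q))"
  have sm: "smooth2 f1" "smooth2 f2"
    using assms(1) by (auto simp: smooth_map2_def f1_def f2_def)
  obtain P R Q where PQR: "P > 0" "Q > 0" "P * Q - R\<^sup>2 = 1"
    and metric: "\<And>z. metric11 f z = P * sqrt (metric_det f z)" "\<And>z. metric12 f z = R * sqrt (metric_det f z)"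
      "\<And>z. metric22 f z = Q * sqrt (metric_det f z)"
    by (rule minimal_graph_metric_conformally_constant[OF assms], rule that)
  have Q0: "Q \<noteq> 0" using PQR(2) by simp
  define L where "L = isothermal_point R Q"
  have eq: "Q * partial 1 (partial 1 g) p - 2 * R * partial 1 (partial 2 g) p + P * partial 2 (partial 2 g) p = 0"
    if "g = f1 \<or> g = f2" for g p
  proof -
    have "metric22 f p * partial 1 (partial 1 g) p - 2 * metric12 f p * partial 1 (partial 2 g) p
        + metric11 f p * partial 2 (partial 2 g) p = 0"
      using minimal_graph_equation[OF assms, of p, folded f1_def f2_def] that by blast
    moreover have "metric22 f p * partial 1 (partial 1 g) p - 2 * metric12 f p * partial 1 (partial 2 g) p
        + metric11 f p * partial 2 (partial 2 g) p = sqrt (metric_det f p) * (Q * partial 1 (partial 1 g) p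
        - 2 * R * partial 1 (partial 2 g) p         + P * partial 2 (partial 2 g) p)"
      unfolding metric by algebra
    ultimately show ?thesis using metric_det_pos[of f p] by simp
  qed
  define G1 G2 where "G1 = isothermal_grad R Q f1" and "G2 = isothermal_grad R Q f2"
  define X Y where "X w = isothermal_hess R Q f1 (L w)" and "Y w = isothermal_hess R Q f2 (L w)" for w
  have d1: "(G1 has_field_derivative X w) (at w)" and d2: "(G2 has_field_derivative Y w) (at w)" for w
    unfolding G1_def G2_def X_def Y_def L_def
    by (rule isothermal_grad_derivative[OF _ PQR(3) Q0]; use sm eq in blast)+
  define \<psi> \<eta> where "\<psi> w = G1 w + \<i> * G2 w" and "\<eta> w = G1 w - \<i> * G2 w" for w
  have d\<psi>: "(\<psi> has_field_derivative X w + \<i> * Y w) (at w)" and d\<eta>: "(\<eta> has_field_derivative X w - \<i> * Y w) (at w)" for w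
    unfolding \<psi>_def[abs_def] \<eta>_def[abs_def] by (auto intro!: derivative_eq_intros d1 d2)
  have hol: "\<psi> holomorphic_on UNIV" "\<eta> holomorphic_on UNIV"
    using d\<psi> d\<eta> by (auto simp: holomorphic_on_open)
  define e where "e = - (1 + (Complex (R / Q) (1 / Q))\<^sup>2)"
  have \<psi>\<eta>: "\<psi> w * \<eta> w = e" for w
  proof -
    define \<kappa> W where "\<kappa> = Complex (R / Q) (1 / Q)" and "W = sqrt (metric_det f (L w))"
    have \<kappa>: "of_real Q * \<kappa> = of_real R + \<i>"
      using Q0 by (simp add: \<kappa>_def complex_eq_iff)
    have "1 + \<kappa>\<^sup>2 + (G1 w)\<^sup>2 + (G2 w)\<^sup>2
        = of_real (metric11 f (L w)) - 2 * \<kappa> * of_real (metric12 f (L w)) + \<kappa>\<^sup>2 * of_real (metric22 f (L w))"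
      unfolding G1_def G2_def isothermal_grad_def metric11_def metric12_def metric22_def
      by (simp add: L_def \<kappa>_def[symmetric] f1_def f2_def power2_eq_square algebra_simps)
    also have "\<dots> = of_real W * (of_real P - 2 * \<kappa> * of_real R + \<kappa>\<^sup>2 * of_real Q)"
      by (simp add: metric W_def algebra_simps)
    \<comment> \<open>\<kappa> = (R + i)/Q solves this quadratic, whose discriminant is governed by
      P Q - R^2 = 1.\<close>
    also have "of_real P - 2 * \<kappa> * of_real R + \<kappa>\<^sup>2 * of_real Q = 0"
    proof -
      have "complex_of_real P * of_real Q = of_real R ^ 2 + 1"
        using PQR(3) by (metis add.commute diff_eq_eq of_real_1 of_real_add of_real_mult of_real_power)
      then have "of_real Q * (of_real P - 2 * \<kappa> * of_real R + \<kappa>\<^sup>2 * of_real Q) = 0"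
        using \<kappa> i_squared by algebra
      then show ?thesis using Q0 by simp
    qed
    finally have "(G1 w)\<^sup>2 + (G2 w)\<^sup>2 = e"
      unfolding e_def \<kappa>_def by (simp add: algebra_simps eq_neg_iff_add_eq_0)
    then show ?thesis
      by (simp add: \<psi>_def \<eta>_def power2_eq_square algebra_simps)
  qed
  have disc: "hess_disc f1 f1 (L w) = - (Q\<^sup>2 * Re (X w * cnj (X w)))"
    "hess_disc f1 f2 (L w) = - (Q\<^sup>2 * Re (X w * cnj (Y w)))"
    "hess_disc f2 f2 (L w) = - (Q\<^sup>2 * Re (Y w * cnj (Y w)))" for w
    unfolding X_def Y_def by (rule hess_disc_isothermal[OF PQR(3) Q0 eq eq]; simp)+
  note curv = curvature_isothermal[OF assms disc[unfolded f1_def f2_def]]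
  show ?thesis
  proof (cases "e = 0")
    case True
    then have "(Complex (R / Q) (1 / Q))\<^sup>2 = -1"
      by (simp add: e_def add_eq_0_iff)
    \<comment> \<open>So e = 0 exactly when x + iy is already isothermal; the Cauchy-Riemann
      equations then appear in the original variables.\<close>
    then have "R = 0 \<and> 1 / Q\<^sup>2 = 1"
      using Q0 by (auto simp: complex_eq_iff power2_eq_square)
    then have RQ: "R = 0" "Q = 1"
      using PQR(2) by (auto simp: field_simps power2_eq_1_iff)
    have L: "L w = (Re w, Im w)" for w by (simp add: L_def isothermal_point_def RQ)
    have i: "Complex 0 1 = \<i>" by (simp add: complex_eq_iff)
    have G: "G1 w = Complex (partial 1 f1 (L w)) (- partial 2 f1 (L w))"
      "G2 w = Complex (partial 1 f2 (L w)) (- partial 2 f2 (L w))" for w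
      by (simp_all add: G1_def G2_def isothermal_grad_def L_def RQ i complex_eq_iff)
    have d: "((\<lambda>z. f1 (Re z, Im z)) has_derivative (\<lambda>h. partial 1 f1 (L z) * Re h + partial 2 f1 (L z) * Im h)) (at z)"
        "((\<lambda>z. f2 (Re z, Im z)) has_derivative (\<lambda>h. partial 1 f2 (L z) * Re h + partial 2 f2 (L z) * Im h)) (at z)" for z
      unfolding L by (rule has_derivative_Re_Im; rule smooth2_has_derivative; rule sm)+
    have "(\<forall>w. \<psi> w = 0) \<or> (\<forall>w. \<eta> w = 0)"
      by (rule entire_product_zero[OF hol]) (simp add: \<psi>\<eta> True)
    then show ?thesis
    proof
      assume zero: "\<forall>w. \<psi> w = 0"
      have CR: "partial 1 f1 (L w) = - partial 2 f2 (L w)" "partial 2 f1 (L w) = partial 1 f2 (L w)" for w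
        using spec[OF zero, of w] by (auto simp: \<psi>_def G complex_eq_iff)
      have "((\<lambda>z. Complex (f1 (Re z, Im z)) (- f2 (Re z, Im z))) has_field_derivative
          Complex (partial 1 f1 (L z)) (- partial 1 f2 (L z))) (at z)" for z
        unfolding has_field_derivative_def
        by (rule has_derivative_eq_rhs, (rule has_derivative_Complex has_derivative_minus d)+)
           (simp add: fun_eq_iff complex_eq_iff CR algebra_simps)
      then have "(\<lambda>z. cnj (Complex (f1 (Re z, Im z)) (f2 (Re z, Im z)))) holomorphic_on UNIV"
        unfolding complex_cnj by (auto simp: holomorphic_on_open)
      then show ?thesis
        by (simp add: complex_analytic_graph_def Let_def f1_def f2_def)
    next
      assume zero: "\<forall>w. \<eta> w = 0"
      have CR: "partial 1 f1 (L w) = partial 2 f2 (L w)" "partial 2 f1 (L w) = - partial 1 f2 (L w)" for w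
        using spec[OF zero, of w] by (auto simp: \<eta>_def G complex_eq_iff)
      have "((\<lambda>z. Complex (f1 (Re z, Im z)) (f2 (Re z, Im z))) has_field_derivative
          Complex (partial 1 f1 (L z)) (partial 1 f2 (L z))) (at z)" for z
        unfolding has_field_derivative_def
        by (rule has_derivative_eq_rhs, (rule has_derivative_Complex d)+)
           (simp add: fun_eq_iff complex_eq_iff CR algebra_simps)
      then have "(\<lambda>z. Complex (f1 (Re z, Im z)) (f2 (Re z, Im z))) holomorphic_on UNIV"
        by (auto simp: holomorphic_on_open)
      then show ?thesis
        by (simp add: complex_analytic_graph_def Let_def f1_def f2_def)
    qed
  next
    case e: False
    have nz: "\<psi> w \<noteq> 0" "\<eta> w \<noteq> 0" for w using \<psi>\<eta>[of w] e by auto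
    \<comment> \<open>Differentiating the constant product: \<psi>'/\<psi> = - \<eta>'/\<eta>. The
      squared modulus of this common quotient is the factor \<open>k\<close> that cancels
      below.\<close>
    have \<eta>': "\<psi> w * (X w - \<i> * Y w) = - (X w + \<i> * Y w) * \<eta> w" for w
    proof -
      have "((\<lambda>w. \<psi> w * \<eta> w) has_field_derivative \<psi> w * (X w - \<i> * Y w) + (X w + \<i> * Y w) * \<eta> w) (at w)"
        by (rule DERIV_mult'[OF d\<psi> d\<eta>])
      moreover have "((\<lambda>w. \<psi> w * \<eta> w) has_field_derivative 0) (at w)"
        by (simp add: \<psi>\<eta>)
      ultimately have "\<psi> w * (X w - \<i> * Y w) + (X w + \<i> * Y w) * \<eta> w = 0"
        by (rule DERIV_unique)
      then show ?thesis by algebra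
    qed
    have XY0: "X w = 0 \<and> Y w = 0" if "X w + \<i> * Y w = 0" for w
    proof -
      have "X w - \<i> * Y w = 0" using \<eta>'[of w] nz that by auto
      with that have "2 * X w = 0" by (metis add_diff_cancel_left' add_diff_eq diff_add_cancel diff_zero mult_2)
      with that show ?thesis by simp
    qed
    show ?thesis
    proof (cases "\<psi> constant_on UNIV")
      case True
      then obtain c where "\<psi> = (\<lambda>_. c)" by (auto simp: constant_on_def)
      then have "X w + \<i> * Y w = 0" for w
        using DERIV_unique[OF d\<psi>[of w]] by auto
      then have "X w = 0 \<and> Y w = 0" for w by (rule XY0)
      then have "gauss_curv f (L w) = 0" for w using curv(1) by blast
      then have "gauss_curv f p = 0" for p
        using isothermal_point_surj[OF Q0] unfolding L_def by metis
      then show ?thesis by simp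
    next
      case False
      obtain w0 where w0: "norm (\<psi> w0) = norm (\<eta> w0)"
        using entire_reciprocal_norms_meet[OF hol \<psi>\<eta> e False] .
      \<comment> \<open>A continuous majorant of the curvature ratio that involves first derivatives
        only and vanishes at \<open>w0\<close>.\<close>
      define r where "r w = sqrt (metric_det f (L w)) * (\<bar>(norm (\<psi> w))\<^sup>2 - (norm (\<eta> w))\<^sup>2\<bar>
          / ((norm (\<psi> w))\<^sup>2 + (norm (\<eta> w))\<^sup>2))" for w
      have bound: "gauss_curv f (L w) < 0" "\<bar>normal_curv f (L w)\<bar> / \<bar>gauss_curv f (L w)\<bar> \<le> r w"
        if w: "X w + \<i> * Y w \<noteq> 0" for w
      proof -
        have "X w \<noteq> 0 \<or> Y w \<noteq> 0" using w by auto
        note R = curvature_ratio_le[OF metric_det_pos PQR(2) this curv(2,3)]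
        show "gauss_curv f (L w) < 0" by (rule R(1))
        define k where "k = (norm ((X w + \<i> * Y w) / \<psi> w))\<^sup>2"
        have k: "k > 0" using w nz by (simp add: k_def)
        have "X w + \<i> * Y w = \<psi> w * ((X w + \<i> * Y w) / \<psi> w)" using nz by simp
        then have 1: "(norm (X w + \<i> * Y w))\<^sup>2 = (norm (\<psi> w))\<^sup>2 * k"
          unfolding k_def by (metis norm_mult power_mult_distrib)
        have "X w - \<i> * Y w = - \<eta> w * ((X w + \<i> * Y w) / \<psi> w)"
          using \<eta>'[of w] nz[of w] by (simp add: field_simps)
        then have 2: "(norm (X w - \<i> * Y w))\<^sup>2 = (norm (\<eta> w))\<^sup>2 * k"
          unfolding k_def by (metis norm_minus_cancel norm_mult power_mult_distrib)
        have "\<bar>(norm (\<psi> w))\<^sup>2 * k - (norm (\<eta> w))\<^sup>2 * k\<bar> / ((norm (\<psi> w))\<^sup>2 * k + (norm (\<eta> w))\<^sup>2 * k)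
            = \<bar>(norm (\<psi> w))\<^sup>2 - (norm (\<eta> w))\<^sup>2\<bar> / ((norm (\<psi> w))\<^sup>2 + (norm (\<eta> w))\<^sup>2)"
          using k by (simp add: left_diff_distrib[symmetric] distrib_right[symmetric] abs_mult)
        then show "\<bar>normal_curv f (L w)\<bar> / \<bar>gauss_curv f (L w)\<bar> \<le> r w"
          using R(2) unfolding 1 2 r_def by simp
      qed
      have "Inf ((\<lambda>p. \<bar>normal_curv f p\<bar> / \<bar>gauss_curv f p\<bar>) ` {p. gauss_curv f p < 0}) = 0"
      proof (rule cInf_eq)
        fix y assume y: "\<And>x. x \<in> (\<lambda>p. \<bar>normal_curv f p\<bar> / \<bar>gauss_curv f p\<bar>) ` {p. gauss_curv f p < 0} \<Longrightarrow> y \<le> x"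
        show "y \<le> 0"
        proof (rule field_le_epsilon)
          fix \<epsilon> :: real assume \<epsilon>: "\<epsilon> > 0"
          have contL: "continuous_on UNIV L"
            unfolding L_def isothermal_point_def[abs_def] by (intro continuous_intros) (simp add: Q0)
          have contD: "continuous_on UNIV (metric_det f)"
            unfolding metric_det_eq[abs_def]
            by (intro continuous_intros smooth2_continuous smooth2_partial sm[unfolded f1_def f2_def]) auto
          have "continuous_on UNIV r"
            unfolding r_def[abs_def]
            by (intro continuous_intros continuous_on_compose2[OF contD contL] holomorphic_on_imp_continuous_on hol)
               (use nz in \<open>auto simp: sum_power2_eq_zero_iff\<close>)
          then have "open {w. r w < \<epsilon>}"
            by (intro open_Collect_less continuous_intros)
          moreover have "w0 \<in> {w. r w < \<epsilon>}" using \<epsilon> by (simp add: r_def w0)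
          ultimately obtain \<delta> where \<delta>: "\<delta> > 0" "ball w0 \<delta> \<subseteq> {w. r w < \<epsilon>}"
            using open_contains_ball by blast
          \<comment> \<open>The derivative of \<psi> may vanish at \<open>w0\<close>, where K would
            then be 0. It cannot vanish on the whole ball, for \<psi> would be constant there and
            hence everywhere.\<close>
          have "\<exists>w\<in>ball w0 \<delta>. X w + \<i> * Y w \<noteq> 0"
          proof (rule ccontr)
            assume "\<not> ?thesis"
            then have "(\<psi> has_field_derivative 0) (at w within ball w0 \<delta>)" if "w \<in> ball w0 \<delta>" for w
              using d\<psi>[of w] that by (metis has_field_derivative_at_within)
            then have "\<psi> constant_on ball w0 \<delta>"
              unfolding constant_on_def by (intro has_field_derivative_zero_constant) auto
            then have "\<psi> constant_on UNIV"
              by (intro analytic_continuation'[OF hol(1), of "ball w0 \<delta>" w0])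
                 (use \<delta> in \<open>auto simp: connected_UNIV interior_limit_point\<close>)
            with False show False by blast
          qed
          then obtain w where w: "w \<in> ball w0 \<delta>" "X w + \<i> * Y w \<noteq> 0" by blast
          have "y \<le> \<bar>normal_curv f (L w)\<bar> / \<bar>gauss_curv f (L w)\<bar>"
            using bound(1)[OF w(2)] by (intro y) auto
          also have "\<dots> \<le> r w" by (rule bound(2)[OF w(2)])
          also have "\<dots> < \<epsilon>" using \<delta>(2) w(1) by blast
          finally show "y \<le> 0 + \<epsilon>" by simp
        qed
      qed (auto simp: divide_le_0_iff)
      then show ?thesis by blast
    qed
  qed
qed

end
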